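(* Let $r\ge1$ and let $\rho^{(1)},\dots,\rho^{(r)}$ be classical discrete weights (each of Charlier, Meixner, Kravchuk or Hahn type, with possibly complex parameters) satisfying Condition MD2. Let $\gamma_1,\dots,\gamma_r$ be real numbers such that for all $j\neq k$ none of the numbers $\gamma_j-\gamma_k$, $\gamma_j-\gamma_k-\alpha_j$, $\gamma_j-\gamma_k-\beta_k$ is an integer. Put $$R(x)=\prod_{j=1}^r\rho^{(j)}(x-\gamma_j),\qquad R_n(x)=\prod_{j=1}^r\rho^{(j)}_n(x-\gamma_j).$$ Then for every integer $n\ge 0$ with $n\le N$, where $N=\min_jN_j$, the function $P_n$ determined by the Rodrigues formula $$P_n(x)\,R(x)=\nabla^nR_n(x)$$ is a polynomial of degree $rn$, and it satisfies the orthogonality conditions $$\sum_{x\in\gamma_j+S_{\rho^{(j)}}}P_n(x)\,x^k\,R(x)=0,\qquad k=0,\dots,n-1,\quad j=1,\dots,r.$$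
   Context: Notation: $\mathbb Z_+=\{0,1,2,\dots\}$; $\nabla f(x)=f(x)-f(x-1)$; $(\alpha)_x=\Gamma(x+\alpha)/\Gamma(\alpha)$ (so $(\alpha)_x=\alpha(\alpha+1)\cdots(\alpha+x-1)$ for $x\in\mathbb Z_+$); $1/\Gamma$ is the entire reciprocal Gamma function, vanishing at nonpositive integers; $b^x=e^{x\log b}$ with one fixed value of $\log b$ for each weight. Classical discrete weights ($\rho=\rho_0$, $m\ge0$ an integer), lattices $S_\rho$, and quotients $u_m(x)=\rho_{m+1}(x)/\rho_m(x)$, $v_m(x)=\rho_{m+1}(x-1)/\rho_m(x)$: - Charlier: $\rho_m(x)=\dfrac{b^x}{\Gamma(x+1)}$, $S_\rho=\mathbb Z_+$, $u_m=1$, $v_m=x/b$. - Meixner: $\rho_m(x)=\dfrac{b^x\,\Gamma(x+\alpha+m)}{\Gamma(x+1)}$, $S_\rho=\mathbb Z_+$, $u_m=x+\alpha+m$, $v_m=x/b$. - Kravchuk ($N\ge 0$ an integer): $\rho_m(x)=\dfrac{b^x}{\Gamma(x+1)\Gamma(N-m-x+1)}$, $S_\rho=\{0,1,\dots,N\}$, $u_m=N-m-x$, $v_m=x/b$. - Hahn ($N\ge 0$ an integer): $\rho_m(x)=\dfrac{(\alpha+m)_x\,(\beta+m)_{N-m-x}}{\Gamma(x+1)\Gamma(N-m-x+1)}$, $S_\rho=\{0,1,\dots,N\}$, $u_m=\dfrac{(x+\alpha+m)(N-m-x)}{(\alpha+m)(\beta+m)}$, $v_m=\dfrac{x(N-x+\beta)}{(\alpha+m)(\beta+m)}$.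 To each weight $\rho^{(j)}$ associate its quadruple $(\alpha_j,\beta_j,b_j,N_j)$ of parameters, where: $b_j=1$ for a Hahn weight; $\beta_j=0$ for non-Hahn weights; $\alpha_j=0$ for Charlier and Kravchuk weights; $N_j=+\infty$ for Charlier and Meixner weights; the other entries are the parameters of the weight. Let $r_C,r_M,r_K,r_H$ be the numbers of Charlier, Meixner, Kravchuk and Hahn weights among $\rho^{(1)},\dots,\rho^{(r)}$ (so $r_C+r_M+r_K+r_H=r$), and put $B=\prod_{j=1}^rb_j$, $N=\min_jN_j$. Condition MD2 consists of: (0) $B\ne0$, and $\alpha_j\notin\{0,-1,-2,\dots\}$ for each Meixner weight $\rho^{(j)}$; (1) if $r_C=0$ and $r_M>0$, then $|B|<1$; (2) if $r_K=r$, then $B\neq(-1)^r$; (3) if $r_H>0$, then $r_K=r-1$, $B=(-1)^{r-1}$, and, with $\rho^{(r)}$ denoting the (only) Hahn weight, $\alpha_r,\beta_r\notin\{0,-1,\dots,1-N_r\}$ and $\alpha_r+\beta_r+rn-\sum_{j=1}^{r-1}N_j\notin\{0,-1,\dots,-n\}$ for all $n\in\{0,1,\dots,N-1\}$. The Rodrigues formula is understood as an identity of meromorphic functions of $x$, i.e. $P_n(x)=\sum_{k=0}^n(-1)^k\binom nk\dfrac{R_n(x-k)}{R(x)}$, where the quotients are computed from the listed $u_m,v_m$: with $U_m(x)=\prod_ju^{(j)}_m(x-\gamma_j)$ and $V_m(x)=\prod_jv_m^{(j)}(x-\gamma_j)$, $\dfrac{R_n(x-k)}{R(x)}=\prod_{i=0}^{k-1}V_i(x-i)\prod_{i=k}^{n-1}U_i(x-k)$.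 If a Hahn parameter $\alpha$ is a nonpositive integer, then $(\alpha)_x$ is given by the product formula for $x\in\mathbb Z_+$ and equals $0$ for noninteger $x$ (as $1/\Gamma(\alpha)=0$); similarly for $\beta$. *)

theory Defs
  imports "HOL-Analysis.Analysis" "HOL-Library.Extended_Nat"
begin

text \<open>
  Constructor arguments: \<open>Charlier b\<close>, \<open>Meixner \<alpha> b\<close>, \<open>Kravchuk b N\<close>, \<open>Hahn \<alpha> \<beta> N\<close>.
\<close>

datatype weight =
    is_Charlier: Charlier complex
  | is_Meixner: Meixner complex complex
  | is_Kravchuk: Kravchuk complex nat
  | is_Hahn: Hahn complex complex nat

primrec par_alpha :: "weight \<Rightarrow> complex" where
  "par_alpha (Charlier b) = 0"
| "par_alpha (Meixner \<alpha> b) = \<alpha>"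
| "par_alpha (Kravchuk b N) = 0"
| "par_alpha (Hahn \<alpha> \<beta> N) = \<alpha>"

primrec par_beta :: "weight \<Rightarrow> complex" where
  "par_beta (Charlier b) = 0"
| "par_beta (Meixner \<alpha> b) = 0"
| "par_beta (Kravchuk b N) = 0"
| "par_beta (Hahn \<alpha> \<beta> N) = \<beta>"

primrec par_b :: "weight \<Rightarrow> complex" where
  "par_b (Charlier b) = b"
| "par_b (Meixner \<alpha> b) = b"
| "par_b (Kravchuk b N) = b"
| "par_b (Hahn \<alpha> \<beta> N) = 1"

primrec par_N :: "weight \<Rightarrow> enat" where
  "par_N (Charlier b) = \<infinity>"
| "par_N (Meixner \<alpha> b) = \<infinity>"
| "par_N (Kravchuk b N) = enat N"
| "par_N (Hahn \<alpha> \<beta> N) = enat N"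

text \<open>
  The shifted factorial \<open>(a)\<^sub>x = \<Gamma>(x+a)/\<Gamma>(a)\<close> with complex \<open>x\<close>.  For \<open>x \<in> \<nat>\<close> it is the
  product, also when \<open>a\<close> is a nonpositive integer; for such \<open>a\<close> and \<open>x \<notin> \<nat>\<close> it is \<open>0\<close>,
  because \<open>rGamma a = 0\<close>.
\<close>

definition poch :: "complex \<Rightarrow> complex \<Rightarrow> complex" where
  "poch a x = (if x \<in> \<nat> then pochhammer a (nat \<lfloor>Re x\<rfloor>) else Gamma (x + a) * rGamma a)"

text \<open>
  In \<open>rho l w m x\<close>, \<open>l\<close> is the chosen value of \<open>log b\<close>, so that \<open>b\<^sup>x\<close> is \<open>exp (l * x)\<close>;
  it is not used for a Hahn weight.
\<close>

primrec rho :: "complex \<Rightarrow> weight \<Rightarrow> nat \<Rightarrow> complex \<Rightarrow> complex" where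
  "rho l (Charlier b) m x = exp (l * x) * rGamma (x + 1)"
| "rho l (Meixner \<alpha> b) m x =
     exp (l * x) * Gamma (x + \<alpha> + of_nat m) * rGamma (x + 1)"
| "rho l (Kravchuk b N) m x =
     exp (l * x) * rGamma (x + 1) * rGamma (of_nat N - of_nat m - x + 1)"
| "rho l (Hahn \<alpha> \<beta> N) m x =
     poch (\<alpha> + of_nat m) x * poch (\<beta> + of_nat m) (of_nat N - of_nat m - x)
       * rGamma (x + 1) * rGamma (of_nat N - of_nat m - x + 1)"

definition weight_lattice :: "weight \<Rightarrow> complex set" where
  "weight_lattice w = of_nat ` {i. enat i \<le> par_N w}"

text \<open>
  The quotients \<open>\<rho>\<^sub>m\<^sub>+\<^sub>1(x) / \<rho>\<^sub>m(x)\<close> and \<open>\<rho>\<^sub>m\<^sub>+\<^sub>1(x-1) / \<rho>\<^sub>m(x)\<close>, cancelled to rational functions;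
  in this form they are also used where \<open>\<rho>\<^sub>m\<close> vanishes or has a pole.
\<close>

primrec quot_u :: "weight \<Rightarrow> nat \<Rightarrow> complex \<Rightarrow> complex" where
  "quot_u (Charlier b) m x = 1"
| "quot_u (Meixner \<alpha> b) m x = x + \<alpha> + of_nat m"
| "quot_u (Kravchuk b N) m x = of_nat N - of_nat m - x"
| "quot_u (Hahn \<alpha> \<beta> N) m x =
     (x + \<alpha> + of_nat m) * (of_nat N - of_nat m - x) / ((\<alpha> + of_nat m) * (\<beta> + of_nat m))"

primrec quot_v :: "weight \<Rightarrow> nat \<Rightarrow> complex \<Rightarrow> complex" where
  "quot_v (Charlier b) m x = x / b"
| "quot_v (Meixner \<alpha> b) m x = x / b"
| "quot_v (Kravchuk b N) m x = x / b"
| "quot_v (Hahn \<alpha> \<beta> N) m x =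
     x * (of_nat N - x + \<beta>) / ((\<alpha> + of_nat m) * (\<beta> + of_nat m))"

definition backward_diff :: "(complex \<Rightarrow> complex) \<Rightarrow> complex \<Rightarrow> complex" where
  "backward_diff f x = f x - f (x - 1)"

definition Rw :: "nat \<Rightarrow> (nat \<Rightarrow> complex) \<Rightarrow> (nat \<Rightarrow> weight) \<Rightarrow> (nat \<Rightarrow> real) \<Rightarrow> nat \<Rightarrow> complex \<Rightarrow> complex"
  where "Rw r l w \<gamma> n x = (\<Prod>j=1..r. rho (l j) (w j) n (x - of_real (\<gamma> j)))"

definition Uw :: "nat \<Rightarrow> (nat \<Rightarrow> weight) \<Rightarrow> (nat \<Rightarrow> real) \<Rightarrow> nat \<Rightarrow> complex \<Rightarrow> complex" where
  "Uw r w \<gamma> m x = (\<Prod>j=1..r. quot_u (w j) m (x - of_real (\<gamma> j)))"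

definition Vw :: "nat \<Rightarrow> (nat \<Rightarrow> weight) \<Rightarrow> (nat \<Rightarrow> real) \<Rightarrow> nat \<Rightarrow> complex \<Rightarrow> complex" where
  "Vw r w \<gamma> m x = (\<Prod>j=1..r. quot_v (w j) m (x - of_real (\<gamma> j)))"

text \<open>
  The Rodrigues expression \<open>\<nabla>\<^sup>n R\<^sub>n / R\<close>: by the binomial formula for \<open>\<nabla>\<^sup>n\<close> it is the sum of the
  \<open>(-1)\<^sup>k (n choose k) R\<^sub>n(x-k) / R(x)\<close>, and the inner products are the quotient
  \<open>R\<^sub>n(x-k) / R(x)\<close> along \<open>R(x), R\<^sub>1(x-1), \<dots>, R\<^sub>k(x-k), R\<^sub>k\<^sub>+\<^sub>1(x-k), \<dots>, R\<^sub>n(x-k)\<close>.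
\<close>

definition rodrigues :: "nat \<Rightarrow> (nat \<Rightarrow> weight) \<Rightarrow> (nat \<Rightarrow> real) \<Rightarrow> nat \<Rightarrow> complex \<Rightarrow> complex" where
  "rodrigues r w \<gamma> n x =
     (\<Sum>k=0..n. (-1) ^ k * of_nat (n choose k) *
        ((\<Prod>i=0..<k. Vw r w \<gamma> i (x - of_nat i)) * (\<Prod>i=k..<n. Uw r w \<gamma> i (x - of_nat k))))"

definition total_b :: "nat \<Rightarrow> (nat \<Rightarrow> weight) \<Rightarrow> complex" where
  "total_b r w = (\<Prod>j=1..r. par_b (w j))"

definition min_N :: "nat \<Rightarrow> (nat \<Rightarrow> weight) \<Rightarrow> enat" where
  "min_N r w = Min ((\<lambda>j. par_N (w j)) ` {1..r})"

definition num_weights :: "(weight \<Rightarrow> bool) \<Rightarrow> nat \<Rightarrow> (nat \<Rightarrow> weight) \<Rightarrow> nat" where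
  "num_weights T r w = card {j \<in> {1..r}. T (w j)}"

text \<open>
  In the last clause the Hahn weight is at an arbitrary index \<open>h\<close> instead of at the last one;
  \<open>num_weights is_Kravchuk r w = r - 1\<close> makes \<open>h\<close> unique, and then \<open>min_N r w\<close> and the \<open>par_N\<close> under
  \<open>the_enat\<close> are finite.
\<close>

definition MD2 :: "nat \<Rightarrow> (nat \<Rightarrow> weight) \<Rightarrow> bool" where
  "MD2 r w \<longleftrightarrow>
     total_b r w \<noteq> 0 \<and>
     (\<forall>j\<in>{1..r}. is_Meixner (w j) \<longrightarrow> par_alpha (w j) \<notin> \<int>\<^sub>\<le>\<^sub>0) \<and>
     (num_weights is_Charlier r w = 0 \<and> num_weights is_Meixner r w > 0 \<longrightarrow> norm (total_b r w) < 1) \<and>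
     (num_weights is_Kravchuk r w = r \<longrightarrow> total_b r w \<noteq> (-1) ^ r) \<and>
     (num_weights is_Hahn r w > 0 \<longrightarrow>
        num_weights is_Kravchuk r w = r - 1 \<and>
        total_b r w = (-1) ^ (r - 1) \<and>
        (\<forall>h\<in>{1..r}. is_Hahn (w h) \<longrightarrow>
           (\<forall>i. enat i < par_N (w h) \<longrightarrow>
              par_alpha (w h) \<noteq> - of_nat i \<and> par_beta (w h) \<noteq> - of_nat i) \<and>
           (\<forall>n. enat n < min_N r w \<longrightarrow>
              (\<forall>i\<le>n. par_alpha (w h) + par_beta (w h) + of_nat (r * n)
                       - (\<Sum>j\<in>{1..r} - {h}. of_nat (the_enat (par_N (w j)))) \<noteq> - of_nat i))))"

end

theory Submission
  imports Defs
begin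

text \<open>
  On every translate of \<open>\<int>\<close> that avoids the exceptional points, \<open>R\<^sub>m\<^sub>+\<^sub>1(x) = R\<^sub>m(x) U\<^sub>m(x)\<close> and
  \<open>R\<^sub>m\<^sub>+\<^sub>1(x-1) = R\<^sub>m(x) V\<^sub>m(x)\<close>, so that \<open>\<nabla>(R\<^sub>m\<^sub>+\<^sub>1 Q) = R\<^sub>m L\<^sub>m Q\<close> with
  \<open>L\<^sub>m Q(x) = U\<^sub>m(x) Q(x) - V\<^sub>m(x) Q(x-1)\<close>, and \<open>P\<^sub>n = L\<^sub>0 \<cdots> L\<^sub>n\<^sub>-\<^sub>1 1\<close>.  Each \<open>L\<^sub>m\<close> raises the degree by
  exactly \<open>r\<close>: if there is no Hahn weight, the coefficients of \<open>U\<^sub>m\<close> and \<open>V\<^sub>m\<close> at \<open>x\<^sup>r\<close> differ; if there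
  is one, their leading coefficients at \<open>x\<^sup>r\<^sup>+\<^sup>1\<close> agree, and the next coefficient of \<open>L\<^sub>m Q\<close> is a nonzero
  multiple of \<open>\<alpha> + \<beta> + r(n-1) - \<Sum>N\<^sub>j + m\<close>.  The lattices \<open>\<gamma>\<^sub>j + S\<close> lie on admissible translates of
  \<open>\<int>\<close> off which \<open>R\<^sub>m\<close> vanishes, so orthogonality is \<open>n\<close>-fold summation by parts; on an infinite lattice
  the ratio \<open>R\<^sub>n(x+1) / R\<^sub>n(x) = U\<^sub>n(x) / V\<^sub>n(x+1)\<close> tends to \<open>0\<close>, or to a number of modulus \<open>|B| < 1\<close>.
\<close>

subsection \<open>The Rodrigues sum as an iterated operator\<close>

text \<open>This encodes the quotient of R at level m + n and point x - k by R at level m and point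
  x, along a path of k steps V followed by n - k steps U. The level m is free because inductions on
  n split off the first step and continue from m + 1.\<close>

definition step_quot ::
  "(nat \<Rightarrow> complex \<Rightarrow> complex) \<Rightarrow> (nat \<Rightarrow> complex \<Rightarrow> complex) \<Rightarrow> nat \<Rightarrow> nat \<Rightarrow> nat \<Rightarrow> complex \<Rightarrow> complex"
  where "step_quot U V m n k x =
    (\<Prod>i=0..<k. V (m + i) (x - of_nat i)) * (\<Prod>i=k..<n. U (m + i) (x - of_nat k))"

definition rodrigues_sum ::
  "(nat \<Rightarrow> complex \<Rightarrow> complex) \<Rightarrow> (nat \<Rightarrow> complex \<Rightarrow> complex) \<Rightarrow> nat \<Rightarrow> nat \<Rightarrow> complex \<Rightarrow> complex"
  where "rodrigues_sum U V m n x =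
    (\<Sum>k=0..n. (-1) ^ k * of_nat (n choose k) * step_quot U V m n k x)"

lemma rodrigues_eq_sum: "rodrigues r w \<gamma> n x = rodrigues_sum (Uw r w \<gamma>) (Vw r w \<gamma>) 0 n x"
  by (simp add: rodrigues_def rodrigues_sum_def step_quot_def)

lemma step_quot_Suc_Suc:
  "step_quot U V m (Suc n) (Suc k) x = V m x * step_quot U V (Suc m) n k (x - 1)"
proof -
  have "(\<Prod>i=0..<Suc k. V (m + i) (x - of_nat i)) = V m x * (\<Prod>i=0..<k. V (Suc m + i) (x - 1 - of_nat i))"
    by (subst prod.atLeast0_lessThan_Suc_shift) (simp add: algebra_simps)
  moreover have "(\<Prod>i=Suc k..<Suc n. U (m + i) (x - of_nat (Suc k)))
      = (\<Prod>i=k..<n. U (Suc m + i) (x - 1 - of_nat k))"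
    by (subst prod.shift_bounds_Suc_ivl) (simp add: algebra_simps)
  ultimately show ?thesis by (simp add: step_quot_def)
qed

text \<open>By \<open>comm\<close>, the two paths from level m at x to level m + 2 at x - 1 give the
  same quotient. Applied k times, it moves a U step from behind the V steps to the front.\<close>

lemma step_quot_Suc:
  assumes comm: "\<And>m x. V m x * U (Suc m) (x - 1) = U m x * V (Suc m) x"
  shows "k \<le> n \<Longrightarrow> step_quot U V m (Suc n) k x = U m x * step_quot U V (Suc m) n k x"
proof (induction k arbitrary: m n x)
  case 0
  have "(\<Prod>i=0..<Suc n. U (m + i) x) = U m x * (\<Prod>i=0..<n. U (Suc m + i) x)"
    by (subst prod.atLeast0_lessThan_Suc_shift) simp
  then show ?case by (simp add: step_quot_def)
next
  case (Suc k)
  then obtain n' where n: "n = Suc n'" "k \<le> n'" by (cases n) auto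
  have "step_quot U V m (Suc n) (Suc k) x = V m x * step_quot U V (Suc m) (Suc n') k (x - 1)"
    by (simp add: step_quot_Suc_Suc n)
  also have "\<dots> = (V m x * U (Suc m) (x - 1)) * step_quot U V (Suc (Suc m)) n' k (x - 1)"
    using Suc.IH[OF n(2)] by simp
  also have "\<dots> = U m x * step_quot U V (Suc m) n (Suc k) x"
    by (simp add: comm step_quot_Suc_Suc n)
  finally show ?case .
qed

lemma rodrigues_sum_0 [simp]: "rodrigues_sum U V m 0 x = 1"
  by (simp add: rodrigues_sum_def step_quot_def)

text \<open>Pascal's rule sorts the terms by the first step of the path: those with n choose k begin
  with U at x, those with n choose k - 1 begin with V and continue at x - 1.\<close>

lemma rodrigues_sum_Suc:
  assumes comm: "\<And>m x. V m x * U (Suc m) (x - 1) = U m x * V (Suc m) x"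
  shows "rodrigues_sum U V m (Suc n) x
    = U m x * rodrigues_sum U V (Suc m) n x - V m x * rodrigues_sum U V (Suc m) n (x - 1)"
proof -
  define q where "q = (\<lambda>k. step_quot U V m (Suc n) k x)"
  have "rodrigues_sum U V m (Suc n) x = (\<Sum>k=0..Suc n. (-1) ^ k * of_nat (Suc n choose k) * q k)"
    by (simp add: rodrigues_sum_def q_def)
  also have "\<dots> = q 0 + (\<Sum>k=0..n. (-1) ^ Suc k * of_nat (Suc n choose Suc k) * q (Suc k))"
    by (subst sum.atLeast0_atMost_Suc_shift) simp
  also have "\<dots> = (q 0 + (\<Sum>k=0..n. (-1) ^ Suc k * of_nat (n choose Suc k) * q (Suc k)))
      - (\<Sum>k=0..n. (-1) ^ k * of_nat (n choose k) * q (Suc k))"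
    by (simp add: algebra_simps sum.distrib sum_subtractf sum_negf)
  \<comment> \<open>The term k = n + 1 may be added and dropped, since n choose n + 1 is 0.\<close>
  also have "q 0 + (\<Sum>k=0..n. (-1) ^ Suc k * of_nat (n choose Suc k) * q (Suc k))
      = (\<Sum>k=0..Suc n. (-1) ^ k * of_nat (n choose k) * q k)"
    by (subst sum.atLeast0_atMost_Suc_shift) simp
  also have "\<dots> = (\<Sum>k=0..n. (-1) ^ k * of_nat (n choose k) * q k)"
    by simp
  also have "\<dots> = U m x * rodrigues_sum U V (Suc m) n x"
    by (auto simp: rodrigues_sum_def q_def step_quot_Suc[where U=U and V=V, OF comm] sum_distrib_left intro!: sum.cong)
  also have "(\<Sum>k=0..n. (-1) ^ k * of_nat (n choose k) * q (Suc k))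
      = V m x * rodrigues_sum U V (Suc m) n (x - 1)"
    by (auto simp: rodrigues_sum_def q_def step_quot_Suc_Suc sum_distrib_left intro!: sum.cong)
  finally show ?thesis .
qed

text \<open>Multiplying by the weight instead of dividing keeps the formula meaningful where the
  weight vanishes. \<open>L\<close> is a set on which both shift relations hold; the iterated
  difference looks at x - 1, hence the closure condition.\<close>

lemma rodrigues_sum_times_weight:
  assumes comm: "\<And>m x. V m x * U (Suc m) (x - 1) = U m x * V (Suc m) x"
    and up: "\<And>m x. \<lbrakk>m < M; x \<in> L\<rbrakk> \<Longrightarrow> R (Suc m) x = R m x * U m x"
    and down: "\<And>m x. \<lbrakk>m < M; x \<in> L\<rbrakk> \<Longrightarrow> R (Suc m) (x - 1) = R m x * V m x"
    and shift: "\<And>x. x \<in> L \<Longrightarrow> x - 1 \<in> L"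
  shows "\<lbrakk>m + n = M; x \<in> L\<rbrakk> \<Longrightarrow> rodrigues_sum U V m n x * R m x = (backward_diff ^^ n) (R M) x"
proof (induction n arbitrary: m x)
  case 0
  then show ?case by simp
next
  case (Suc n)
  have IH: "rodrigues_sum U V (Suc m) n y * R (Suc m) y = (backward_diff ^^ n) (R M) y"
    if "y \<in> L" for y
    using Suc.IH[of "Suc m" y] Suc.prems that by simp
  have m: "m < M" using Suc.prems by simp
  have "(backward_diff ^^ Suc n) (R M) x
      = rodrigues_sum U V (Suc m) n x * R (Suc m) x
        - rodrigues_sum U V (Suc m) n (x - 1) * R (Suc m) (x - 1)"
    using Suc.prems by (simp add: backward_diff_def IH shift)
  also have "\<dots> = rodrigues_sum U V m (Suc n) x * R m x"
    using Suc.prems by (simp add: up[OF m] down[OF m] rodrigues_sum_Suc[where U=U and V=V, OF comm] algebra_simps)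
  finally show ?case by simp
qed

section \<open>Degree and top coefficient of u(x) q(x) - v(x) q(x - 1)\<close>

lemma coeff_mult_add_bound:
  fixes p q :: "'a::comm_semiring_1 poly"
  assumes "degree p \<le> a" "degree q \<le> b"
  shows "coeff (p * q) (a + b) = coeff p a * coeff q b"
proof -
  have "coeff (p * q) (a + b) = (\<Sum>i\<le>a + b. coeff p i * coeff q (a + b - i))"
    by (rule coeff_mult)
  also have "\<dots> = (\<Sum>i\<in>{a}. coeff p i * coeff q (a + b - i))"
  proof (rule sum.mono_neutral_right)
    show "\<forall>i\<in>{..a + b} - {a}. coeff p i * coeff q (a + b - i) = 0"
    proof
      fix i assume i: "i \<in> {..a + b} - {a}"
      show "coeff p i * coeff q (a + b - i) = 0"
      proof (cases "i < a")
        case True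
        then have "coeff q (a + b - i) = 0"
          using assms by (intro coeff_eq_0) simp
        then show ?thesis by simp
      next
        case False
        then have "coeff p i = 0" using i assms by (intro coeff_eq_0) simp
        then show ?thesis by simp
      qed
    qed
  qed auto
  finally show ?thesis by simp
qed

text \<open>The backward difference acts on the top coefficient like the derivative, and the
  induction uses its product rule for x q(x).\<close>

lemma poly_shift_diff:
  fixes q :: "'a::idom poly"
  assumes "degree q \<le> Suc d"
  shows "degree (q - pcompose q [:- 1, 1:]) \<le> d \<and>
    coeff (q - pcompose q [:- 1, 1:]) d = of_nat (Suc d) * coeff q (Suc d)"
  using assms
proof (induction q arbitrary: d)
  case 0
  then show ?case by simp
next
  case (pCons a q)
  define D where "D = q - pcompose q [:- 1, 1:]"
  \<comment> \<open>The difference of x q(x) is x D(x) + q(x - 1), and q(x - 1) is q - D.\<close>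
  have eq: "pCons a q - pcompose (pCons a q) [:- 1, 1:] = pCons 0 D + (q - D)"
    by (simp add: D_def pcompose_pCons algebra_simps)
  have dq: "degree q \<le> d"
    using pCons.prems pCons.hyps by (auto split: if_splits)
  show ?case
  proof (cases d)
    case 0
    then obtain c where "q = [:c:]" using dq by (metis degree_eq_zeroE le_zero_eq)
    then show ?thesis using 0 unfolding eq by (simp add: D_def)
  next
    case (Suc d')
    have IH: "degree D \<le> d'" "coeff D d' = of_nat d * coeff q d"
      using pCons.IH[of d'] dq Suc by (simp_all add: D_def)
    have D0: "coeff D d = 0" using IH(1) Suc by (intro coeff_eq_0) simp
    have "degree (pCons 0 D) \<le> d" using IH(1) Suc by (auto simp: degree_pCons_eq_if)
    moreover have "degree (q - D) \<le> d" using IH(1) dq Suc by (intro degree_diff_le) auto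
    ultimately have "degree (pCons 0 D + (q - D)) \<le> d" by (intro degree_add_le)
    moreover have "coeff (pCons 0 D + (q - D)) d = of_nat (Suc d) * coeff (pCons a q) (Suc d)"
      using IH(2) D0 Suc by (simp add: algebra_simps)
    ultimately show ?thesis unfolding eq by blast
  qed
qed

text \<open>With D the backward difference of q, p = (u - v) q + v D. Both summands have degree at
  most s + degree q, and their coefficients there add up to the number in \<open>nz\<close> times
  the leading coefficient of q. The bound \<open>Suc s\<close> serves both situations: without a
  Hahn weight the coefficients at \<open>Suc s\<close> are 0.\<close>

lemma degree_mult_shift_diff:
  fixes u v q :: "'a::idom poly"
  assumes u: "degree u \<le> Suc s" and v: "degree v \<le> Suc s"
    and top: "coeff u (Suc s) = coeff v (Suc s)"
    and nz: "coeff u s - coeff v s + of_nat (degree q) * coeff v (Suc s) \<noteq> 0"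
    and q: "q \<noteq> 0"
  defines "p \<equiv> u * q - v * pcompose q [:- 1, 1:]"
  shows "p \<noteq> 0 \<and> degree p = s + degree q"
proof -
  define D where "D = q - pcompose q [:- 1, 1:]"
  have p: "p = (u - v) * q + v * D" by (simp add: p_def D_def algebra_simps)
  have "degree (u - v) \<le> Suc s" using u v by (intro degree_diff_le)
  then have uv: "degree (u - v) \<le> s"
    using top by (intro degree_le) (metis coeff_diff coeff_eq_0 eq_iff_diff_eq_0 le_less_trans not_less_eq less_antisym)
  have "degree (v * D) \<le> s + degree q \<and>
      coeff (v * D) (s + degree q) = of_nat (degree q) * coeff v (Suc s) * lead_coeff q"
  proof (cases "degree q")
    case 0
    then obtain c where "q = [:c:]" by (metis degree_eq_zeroE)
    then show ?thesis by (simp add: D_def)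
  next
    case (Suc d)
    have D: "degree D \<le> d" "coeff D d = of_nat (Suc d) * lead_coeff q"
      using poly_shift_diff[of q d] Suc by (simp_all add: D_def)
    have "degree (v * D) \<le> Suc s + d" using degree_mult_le[of v D] v D(1) by linarith
    moreover have "coeff (v * D) (Suc s + d) = coeff v (Suc s) * coeff D d"
      by (rule coeff_mult_add_bound[OF v D(1)])
    ultimately show ?thesis using Suc D(2) by (simp add: algebra_simps)
  qed
  moreover have "degree ((u - v) * q) \<le> s + degree q"
    using degree_mult_le[of "u - v" q] uv by linarith
  moreover have "coeff ((u - v) * q) (s + degree q) = (coeff u s - coeff v s) * lead_coeff q"
    using coeff_mult_add_bound[OF uv, of q "degree q"] by simp
  ultimately have deg: "degree p \<le> s + degree q"
    and "coeff p (s + degree q)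
      = (coeff u s - coeff v s + of_nat (degree q) * coeff v (Suc s)) * lead_coeff q"
    unfolding p by (simp_all only: degree_add_le coeff_add distrib_right)
  then have "coeff p (s + degree q) \<noteq> 0" using nz q by simp
  then show ?thesis using deg le_degree by fastforce
qed

text \<open>At level m the operator meets the polynomial produced by the M - m - 1 later levels, of
  degree r (M - m - 1); this is the factor in \<open>nz\<close>.\<close>

lemma rodrigues_sum_degree:
  fixes pu pv :: "nat \<Rightarrow> complex poly"
  assumes comm: "\<And>m x. V m x * U (Suc m) (x - 1) = U m x * V (Suc m) x"
    and U: "\<And>m x. U m x = poly (pu m) x" and V: "\<And>m x. V m x = poly (pv m) x"
    and degU: "\<And>m. m < M \<Longrightarrow> degree (pu m) \<le> Suc r"
    and degV: "\<And>m. m < M \<Longrightarrow> degree (pv m) \<le> Suc r"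
    and top: "\<And>m. m < M \<Longrightarrow> coeff (pu m) (Suc r) = coeff (pv m) (Suc r)"
    and nz: "\<And>m. m < M \<Longrightarrow>
      coeff (pu m) r - coeff (pv m) r + of_nat (r * (M - Suc m)) * coeff (pv m) (Suc r) \<noteq> 0"
  shows "m + n = M \<Longrightarrow> \<exists>p. p \<noteq> 0 \<and> degree p = r * n \<and> (\<forall>x. rodrigues_sum U V m n x = poly p x)"
proof (induction n arbitrary: m)
  case 0
  show ?case by (intro exI[of _ 1]) simp
next
  case (Suc n)
  obtain q where q: "q \<noteq> 0" "degree q = r * n" "\<And>x. rodrigues_sum U V (Suc m) n x = poly q x"
    using Suc.IH[of "Suc m"] Suc.prems by auto
  have "M - Suc m = n" "m < M" using Suc.prems by auto
  then have "pu m * q - pv m * pcompose q [:- 1, 1:] \<noteq> 0 \<and>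
      degree (pu m * q - pv m * pcompose q [:- 1, 1:]) = r + degree q"
    using nz[of m] by (intro degree_mult_shift_diff degU degV top q(1)) (simp_all add: q(2))
  moreover have "rodrigues_sum U V m (Suc n) x
      = poly (pu m * q - pv m * pcompose q [:- 1, 1:]) x" for x
    by (simp add: rodrigues_sum_Suc[where U=U and V=V, OF comm] q(3) U V poly_pcompose algebra_simps)
  ultimately show ?case using q(2) by (metis mult_Suc_right)
qed

subsection \<open>Shift relations of the weights\<close>

text \<open>Raising m and lowering x by 1 fixes the numerator of \<open>quot_u\<close>, and the
  numerator of \<open>quot_v\<close> does not involve m; the Hahn denominators merely change
  places.\<close>

lemma quot_commute:
  "quot_v w m x * quot_u w (Suc m) (x - 1) = quot_u w m x * quot_v w (Suc m) x"
proof (cases w)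
  case (Hahn \<alpha> \<beta> N)
  have "x - 1 + \<alpha> + of_nat (Suc m) = x + \<alpha> + of_nat m"
    "of_nat N - of_nat (Suc m) - (x - 1) = of_nat N - of_nat m - x"
    by simp_all
  then show ?thesis unfolding Hahn quot_u.simps quot_v.simps by (simp only: times_divide_times_eq mult_ac)
qed simp_all

lemma rGamma_shift: "a = b + 1 \<Longrightarrow> rGamma b = b * rGamma a" for a b :: complex
  using rGamma_plus1[of b] by simp

lemma Ints_add_of_nat_iff [simp]:
  "x + of_nat k \<in> \<int> \<longleftrightarrow> x \<in> \<int>" "of_nat k + x \<in> \<int> \<longleftrightarrow> x \<in> \<int>" for x :: "'a::ring_1"
  by (metis Ints_add Ints_diff Ints_of_nat add_diff_cancel_right',
      metis Ints_add Ints_diff Ints_of_nat add_diff_cancel_left')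

lemma Ints_diff_left_iff: "c \<in> \<int> \<Longrightarrow> c - x \<in> \<int> \<longleftrightarrow> x \<in> \<int>" for c x :: "'a::ring_1"
  using Ints_diff[of c "c - x"] Ints_diff[of c x] by auto

lemma Nats_imp_Ints: "x \<in> \<nat> \<Longrightarrow> x \<in> \<int>" for x :: "'a::ring_1"
  using Nats_subset_Ints by blast

lemma poch_of_nat [simp]: "poch a (of_nat n) = pochhammer a n"
  by (simp add: poch_def)

lemma poch_nonint: "x \<notin> \<int> \<Longrightarrow> poch a x = Gamma (x + a) * rGamma a"
  by (auto simp: poch_def dest: Nats_imp_Ints)

text \<open>For natural x this compares two finite products; otherwise x + a avoids the poles of
  Gamma. Negative integers x are left out: there the factor \<open>rGamma (x + 1)\<close> of a Hahn
  weight vanishes.\<close>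

lemma poch_Suc_param:
  assumes "x \<in> \<nat> \<or> x \<notin> \<int> \<and> x + a \<notin> \<int>"
  shows "poch (a + 1) x * a = poch a x * (x + a)"
  using assms
proof
  assume "x \<in> \<nat>"
  then obtain n where x: "x = of_nat n" by (rule Nats_cases)
  have "pochhammer (a + 1) n * a = pochhammer a n * (of_nat n + a)"
    using pochhammer_rec[of a n] pochhammer_rec'[of a n] by (simp add: algebra_simps)
  then show ?thesis by (simp add: x)
next
  assume x: "x \<notin> \<int> \<and> x + a \<notin> \<int>"
  then have "Gamma (x + a + 1) = (x + a) * Gamma (x + a)"
    by (intro Gamma_plus1) (auto dest: nonpos_Ints_Int)
  moreover have "rGamma (a + 1) * a = rGamma a" using rGamma_plus1[of a] by (simp add: mult.commute)
  ultimately show ?thesis using x by (simp add: poch_nonint add.assoc[symmetric] mult_ac)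
qed

lemma poch_pred:
  assumes "x - 1 \<in> \<nat> \<or> x \<notin> \<int>"
  shows "poch (a + 1) (x - 1) * a = poch a x"
  using assms
proof
  assume "x - 1 \<in> \<nat>"
  then obtain n where n: "x - 1 = of_nat n" by (rule Nats_cases)
  then have "x = of_nat (Suc n)" by (simp add: algebra_simps)
  then show ?thesis unfolding n by (simp only: poch_of_nat pochhammer_rec mult.commute)
next
  assume x: "x \<notin> \<int>"
  then have "x - 1 \<notin> \<int>" by (metis Ints_1 Ints_add diff_add_cancel)
  then show ?thesis using x rGamma_plus1[of a] by (simp add: poch_nonint algebra_simps)
qed

text \<open>\<open>quot_u\<close> and \<open>quot_v\<close> of a Hahn weight are junk when \<open>(\<alpha> + m) (\<beta> + m) = 0\<close>.\<close>

definition quot_defined :: "weight \<Rightarrow> nat \<Rightarrow> bool" where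
  "quot_defined w m \<longleftrightarrow>
    (is_Hahn w \<longrightarrow> par_alpha w + of_nat m \<noteq> 0 \<and> par_beta w + of_nat m \<noteq> 0)"

text \<open>The condition depends only on the class of x modulo the integers. At integers,
  reciprocal Gamma factors take care of everything except a Meixner pole at a natural number.
  Elsewhere the two conditions avoid the poles of Gamma(x + \<alpha> + m) and of Gamma(N - x +
  \<beta>).\<close>

definition regular_point :: "weight \<Rightarrow> complex \<Rightarrow> bool" where
  "regular_point w x \<longleftrightarrow>
    (if x \<in> \<int> then is_Meixner w \<longrightarrow> par_alpha w \<notin> \<int>\<^sub>\<le>\<^sub>0
     else x + par_alpha w \<notin> \<int> \<and> x - par_beta w \<notin> \<int>)"

text \<open>Put y = N - m - x. Either a reciprocal Gamma factor vanishes and both sides are 0, or x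
  and y lie where the parameter shifts of \<open>poch\<close> apply; multiplying and dividing by a b
  brings the weight into their form.\<close>

lemma rho_Hahn_Suc:
  assumes A: "\<alpha> + of_nat m \<noteq> 0" and B: "\<beta> + of_nat m \<noteq> 0" and x: "regular_point (Hahn \<alpha> \<beta> N) x"
  defines "w \<equiv> Hahn \<alpha> \<beta> N"
  shows "rho l w (Suc m) x = rho l w m x * quot_u w m x"
    and "rho l w (Suc m) (x - 1) = rho l w m x * quot_v w m x"
proof -
  define a where "a = \<alpha> + of_nat m"
  define b where "b = \<beta> + of_nat m"
  define y where "y = of_nat N - of_nat m - x"
  have rx: "rGamma x = x * rGamma (x + 1)" and ry: "rGamma y = y * rGamma (y + 1)"
    by (rule rGamma_shift, simp)+
  have nonint: "x \<notin> \<int> \<Longrightarrow> y \<notin> \<int> \<and> x + a \<notin> \<int> \<and> y + b \<notin> \<int>"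
  proof -
    assume nx: "x \<notin> \<int>"
    then have "y \<notin> \<int>" by (simp add: y_def Ints_diff_left_iff)
    moreover have "x + a = (x + \<alpha>) + of_nat m" by (simp add: a_def)
    then have "x + a \<notin> \<int>" using x nx by (simp only: Ints_add_of_nat_iff) (simp add: regular_point_def)
    moreover have "y + b = of_nat N - (x - \<beta>)" by (simp add: y_def b_def)
    then have "y + b \<notin> \<int>" using x nx by (simp add: Ints_diff_left_iff regular_point_def)
    ultimately show ?thesis by blast
  qed
  have yint: "x \<in> \<int> \<Longrightarrow> y \<in> \<int>" by (simp add: y_def)
  have dich: "z \<in> \<nat> \<or> z + 1 \<in> \<int>\<^sub>\<le>\<^sub>0" if "z \<in> \<int>" for z :: complex
  proof -
    obtain i where i: "z = of_int i" using \<open>z \<in> \<int>\<close> by (rule Ints_cases)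
    show ?thesis
    proof (cases "i \<ge> 0")
      case True then show ?thesis by (metis i of_nat_nat of_int_of_nat_eq of_nat_in_Nats)
    next
      case False
      then have "z + 1 = of_int (i + 1)" "i + 1 \<le> 0" using i by simp_all
      then show ?thesis by (metis nonpos_Ints_of_int)
    qed
  qed
  \<comment> \<open>This version is for the factor whose \<open>poch\<close> argument is lowered:
    its reciprocal Gamma also vanishes at z = 0, which leaves z at least 1.\<close>
  have dich': "z - 1 \<in> \<nat> \<or> z \<in> \<int>\<^sub>\<le>\<^sub>0" if "z \<in> \<int>" for z :: complex
    using dich[of "z - 1"] that by auto
  have rho1: "rho l w m x = poch a x * poch b y * rGamma (x + 1) * rGamma (y + 1)"
    by (simp add: w_def a_def b_def y_def)
  have "rho l w (Suc m) x = poch (a + 1) x * poch (b + 1) (y - 1) * rGamma (x + 1) * rGamma y"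
    by (simp add: w_def a_def b_def y_def algebra_simps)
  also have "\<dots> = (poch (a + 1) x * a) * (poch (b + 1) (y - 1) * b) * rGamma (x + 1) * rGamma y / (a * b)"
    using A B by (simp add: a_def b_def)
  also have "\<dots> = (poch a x * (x + a)) * poch b y * rGamma (x + 1) * rGamma y / (a * b)"
  proof (cases "rGamma (x + 1) = 0 \<or> rGamma y = 0")
    case False
    then have "x \<in> \<nat> \<or> x \<notin> \<int>" "y - 1 \<in> \<nat> \<or> y \<notin> \<int>"
      using dich[of x] dich'[of y] by (auto simp: rGamma_eq_zero_iff)
    then have "poch (a + 1) x * a = poch a x * (x + a)" "poch (b + 1) (y - 1) * b = poch b y"
      using nonint yint by (blast intro: poch_Suc_param poch_pred)+
    then show ?thesis by simp
  qed auto
  also have "\<dots> = rho l w m x * ((x + a) * y / (a * b))"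
    by (simp add: rho1 ry)
  also have "(x + a) * y / (a * b) = quot_u w m x"
    by (simp add: w_def a_def b_def y_def add_ac)
  finally show "rho l w (Suc m) x = rho l w m x * quot_u w m x" .
  have "rho l w (Suc m) (x - 1) = poch (a + 1) (x - 1) * poch (b + 1) y * rGamma x * rGamma (y + 1)"
    by (simp add: w_def a_def b_def y_def algebra_simps)
  also have "\<dots> = (poch (a + 1) (x - 1) * a) * (poch (b + 1) y * b) * rGamma x * rGamma (y + 1) / (a * b)"
    using A B by (simp add: a_def b_def)
  also have "\<dots> = poch a x * (poch b y * (y + b)) * rGamma x * rGamma (y + 1) / (a * b)"
  proof (cases "rGamma x = 0 \<or> rGamma (y + 1) = 0")
    case False
    then have "x - 1 \<in> \<nat> \<or> x \<notin> \<int>" "y \<in> \<nat> \<or> y \<notin> \<int>"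
      using dich'[of x] dich[of y] by (auto simp: rGamma_eq_zero_iff)
    then have "poch (a + 1) (x - 1) * a = poch a x" "poch (b + 1) y * b = poch b y * (y + b)"
      using nonint yint by (blast intro: poch_Suc_param poch_pred)+
    then show ?thesis by simp
  qed auto
  also have "\<dots> = rho l w m x * (x * (y + b) / (a * b))"
    by (simp add: rho1 rx)
  also have "x * (y + b) / (a * b) = quot_v w m x"
    by (simp add: w_def a_def b_def y_def algebra_simps)
  finally show "rho l w (Suc m) (x - 1) = rho l w m x * quot_v w m x" .
qed

lemma rho_Suc:
  assumes l: "exp l = par_b w" and def: "quot_defined w m" and x: "regular_point w x"
  shows "rho l w (Suc m) x = rho l w m x * quot_u w m x"
    and "rho l w (Suc m) (x - 1) = rho l w m x * quot_v w m x"
proof -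
  have rx: "rGamma x = x * rGamma (x + 1)"
    and rN: "rGamma (of_nat N - of_nat m - x) = (of_nat N - of_nat m - x) * rGamma (of_nat N - of_nat m - x + 1)"
    for N by (rule rGamma_shift, simp)+
  have N1: "of_nat N - (1 + of_nat m) - x + 1 = of_nat N - of_nat m - x"
    "of_nat N + (- of_nat m - x) + 1 = of_nat N - of_nat m - x + 1" for N :: nat
    by simp_all
  have b: "par_b w \<noteq> 0" and exp1: "exp (l * (x - 1)) = exp (l * x) / par_b w"
    using l by (auto simp: algebra_simps exp_diff)
  have "rho l w (Suc m) x = rho l w m x * quot_u w m x \<and>
    rho l w (Suc m) (x - 1) = rho l w m x * quot_v w m x"
  proof (cases w)
    case (Charlier c)
    then show ?thesis using rx exp1 b by simp
  next
    case (Meixner \<alpha> c)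
    \<comment> \<open>A pole of Gamma at a natural x would make \<alpha> a nonpositive integer; at a
      negative integer x the reciprocal Gamma factor is 0.\<close>
    have "rGamma (x + 1) = 0 \<or> x + \<alpha> + of_nat m \<notin> \<int>\<^sub>\<le>\<^sub>0"
    proof (cases "x \<in> \<int>")
      case True
      then obtain i where i: "x = of_int i" by (rule Ints_cases)
      show ?thesis
      proof (cases "i \<ge> 0")
        case True
        have "\<alpha> \<notin> \<int>\<^sub>\<le>\<^sub>0" using x i Meixner by (simp add: regular_point_def)
        moreover have "\<alpha> = (x + \<alpha> + of_nat m) - of_nat (nat i + m)" using True i by simp
        ultimately show ?thesis by (metis nonpos_Ints_diff_Nats of_nat_in_Nats)
      next
        case False
        then have "x + 1 = of_int (i + 1)" "i + 1 \<le> 0" using i by simp_all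
        then show ?thesis by (metis nonpos_Ints_of_int rGamma_eq_zero_iff)
      qed
    next
      case False
      then have "x + \<alpha> + of_nat m \<notin> \<int>" using x Meixner by (simp add: regular_point_def)
      then show ?thesis by (auto dest: nonpos_Ints_Int)
    qed
    then have "Gamma (x + \<alpha> + of_nat m + 1) * rGamma (x + 1)
        = (x + \<alpha> + of_nat m) * Gamma (x + \<alpha> + of_nat m) * rGamma (x + 1)"
      using Gamma_plus1 by auto
    then have "rho l w (Suc m) x = rho l w m x * quot_u w m x"
      by (simp add: Meixner add.assoc[symmetric] add.commute[of 1] mult_ac)
    moreover have "rho l w (Suc m) (x - 1) = rho l w m x * quot_v w m x"
      using Meixner rx exp1 b by (simp add: algebra_simps)
    ultimately show ?thesis by blast
  next
    case (Kravchuk c N)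
    then show ?thesis using rx rN[of N] exp1 b by (simp add: N1)
  next
    case (Hahn \<alpha> \<beta> N)
    then show ?thesis using rho_Hahn_Suc[of \<alpha> m \<beta> N x l] x def by (simp add: quot_defined_def del: rho.simps quot_u.simps quot_v.simps)
  qed
  then show "rho l w (Suc m) x = rho l w m x * quot_u w m x"
    "rho l w (Suc m) (x - 1) = rho l w m x * quot_v w m x"
    by blast+
qed

text \<open>The meromorphic identity is expressed as equality off a sparse set; the points to avoid
  lie on finitely many translates of the integers.\<close>

lemma eventually_cosparse_not_Ints: "\<forall>\<^sub>\<approx>x. x + c \<notin> \<int>" for c :: complex
proof (subst eventually_cosparse_open_eq, simp, rule ballI)
  fix y :: complex
  \<comment> \<open>Any set of integers is closed, in particular the one without y + c.\<close>
  have "open (- (\<int> - {y + c}))" by (metis Diff_subset closed_subset_Ints open_Compl)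
  then have "open ((\<lambda>x. x + c) -` (- (\<int> - {y + c})))"
    by (rule open_vimage) (intro continuous_intros)
  then have "eventually (\<lambda>x. x \<in> (\<lambda>x. x + c) -` (- (\<int> - {y + c}))) (nhds y)"
    by (rule eventually_nhds_in_open) simp
  then show "eventually (\<lambda>x. x + c \<notin> \<int>) (at y)"
    unfolding eventually_at_filter by eventually_elim auto
qed

subsection \<open>Leading coefficients of the quotients\<close>

text \<open>\<open>c\<close> is the shift \<gamma> of the weight. Scalars are pulled out of monic
  linear factors, so that the top coefficient of a product is the product of the scalars and the
  next one is that times the sum of the constant terms.\<close>

primrec poly_u :: "weight \<Rightarrow> nat \<Rightarrow> complex \<Rightarrow> complex poly" where
  "poly_u (Charlier b) m c = 1"
| "poly_u (Meixner \<alpha> b) m c = [:\<alpha> + of_nat m - c, 1:]"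
| "poly_u (Kravchuk b N) m c = smult (- 1) [:of_nat m - of_nat N - c, 1:]"
| "poly_u (Hahn \<alpha> \<beta> N) m c = smult (- 1 / ((\<alpha> + of_nat m) * (\<beta> + of_nat m)))
     ([:\<alpha> + of_nat m - c, 1:] * [:of_nat m - of_nat N - c, 1:])"

primrec poly_v :: "weight \<Rightarrow> nat \<Rightarrow> complex \<Rightarrow> complex poly" where
  "poly_v (Charlier b) m c = smult (1 / b) [:- c, 1:]"
| "poly_v (Meixner \<alpha> b) m c = smult (1 / b) [:- c, 1:]"
| "poly_v (Kravchuk b N) m c = smult (1 / b) [:- c, 1:]"
| "poly_v (Hahn \<alpha> \<beta> N) m c = smult (- 1 / ((\<alpha> + of_nat m) * (\<beta> + of_nat m)))
     ([:- (of_nat N + \<beta> + c), 1:] * [:- c, 1:])"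

lemma poly_monic_linear: "poly [:a, 1:] x = a + x" for a x :: "'a::comm_semiring_1"
  by simp

lemma poly_poly_u: "poly (poly_u w m c) x = quot_u w m (x - c)"
proof (cases w)
  case (Hahn \<alpha> \<beta> N)
  have "(\<alpha> + of_nat m - c + x) * (of_nat m - of_nat N - c + x)
      = - ((x - c + \<alpha> + of_nat m) * (of_nat N - of_nat m - (x - c)))"
    by (simp add: algebra_simps)
  then show ?thesis
    by (simp only: Hahn poly_u.simps quot_u.simps poly_smult poly_mult poly_monic_linear) simp
qed (simp_all add: algebra_simps)

lemma poly_poly_v: "poly (poly_v w m c) x = quot_v w m (x - c)"
proof (cases w)
  case (Hahn \<alpha> \<beta> N)
  have "(- (of_nat N + \<beta> + c) + x) * (- c + x) = - ((x - c) * (of_nat N - (x - c) + \<beta>))"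
    by (simp add: algebra_simps)
  then show ?thesis
    by (simp only: Hahn poly_v.simps quot_v.simps poly_smult poly_mult poly_monic_linear) simp
qed (simp_all add: algebra_simps diff_divide_distrib)

lemma coeff_prod_linear:
  fixes f :: "'b \<Rightarrow> 'a::comm_semiring_1 poly"
  assumes "finite A" "\<And>j. j \<in> A \<Longrightarrow> degree (f j) \<le> 1"
  shows "degree (\<Prod>j\<in>A. f j) \<le> card A \<and> coeff (\<Prod>j\<in>A. f j) (card A) = (\<Prod>j\<in>A. coeff (f j) 1)"
  using assms
proof (induction A rule: finite_induct)
  case (insert i A)
  let ?P = "\<Prod>j\<in>A. f j"
  have IH: "degree ?P \<le> card A" "coeff ?P (card A) = (\<Prod>j\<in>A. coeff (f j) 1)"
    and i: "degree (f i) \<le> 1"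
    using insert by auto
  have "degree (f i * ?P) \<le> 1 + card A"
    using degree_mult_le[of "f i" ?P] IH(1) i by linarith
  moreover have "coeff (f i * ?P) (1 + card A) = coeff (f i) 1 * coeff ?P (card A)"
    by (rule coeff_mult_add_bound[OF i IH(1)])
  ultimately show ?case using insert.hyps IH(2) by simp
qed simp

lemma coeff_prod_monic_linear_top:
  fixes a :: "'b \<Rightarrow> 'a::comm_semiring_1"
  shows "finite A \<Longrightarrow> coeff (\<Prod>j\<in>A. [:a j, 1:]) (card A) = 1"
  using coeff_prod_linear[of A "\<lambda>j. [:a j, 1:]"] by simp

text \<open>The factor \<open>pCons 0\<close> avoids the index \<open>card A - 1\<close>.\<close>

lemma coeff_prod_monic_linear_next:
  fixes a :: "'b \<Rightarrow> 'a::comm_semiring_1"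
  shows "finite A \<Longrightarrow> coeff (pCons 0 (\<Prod>j\<in>A. [:a j, 1:])) (card A) = (\<Sum>j\<in>A. a j)"
proof (induction A rule: finite_induct)
  case (insert i A)
  then show ?case using coeff_prod_monic_linear_top[OF insert.hyps(1), of a] by (simp add: algebra_simps)
qed simp

text \<open>The coefficient of V is 1/B. That of U is 0 if a Charlier weight occurs, has modulus 1 <
  |1/B| if there is a Meixner but no Charlier weight, and is (-1)^r if all weights are
  Kravchuk.\<close>

lemma coeff_diff_nonzero_no_Hahn:
  fixes \<gamma> :: "nat \<Rightarrow> real"
  assumes r: "r \<ge> 1" and MD2: "MD2 r w" and nH: "\<And>j. j \<in> {1..r} \<Longrightarrow> \<not> is_Hahn (w j)"
  defines "pu \<equiv> \<lambda>m. \<Prod>j=1..r. poly_u (w j) m (of_real (\<gamma> j))"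
  defines "pv \<equiv> \<lambda>m. \<Prod>j=1..r. poly_v (w j) m (of_real (\<gamma> j))"
  shows "degree (pu m) \<le> r \<and> degree (pv m) \<le> r \<and> coeff (pu m) r \<noteq> coeff (pv m) r"
proof -
  define \<sigma> :: "nat \<Rightarrow> complex" where "\<sigma> = (\<lambda>j. coeff (poly_u (w j) m (of_real (\<gamma> j))) 1)"
  have B0: "total_b r w \<noteq> 0" using MD2 by (simp add: MD2_def)
  have du: "degree (poly_u (w j) m (of_real (\<gamma> j))) \<le> 1"
    and dv: "degree (poly_v (w j) m (of_real (\<gamma> j))) \<le> 1"
    and cv: "coeff (poly_v (w j) m (of_real (\<gamma> j))) 1 = 1 / par_b (w j)" if "j \<in> {1..r}" for j
    using nH[OF that] by (cases "w j"; force intro: order.trans[OF degree_smult_le])+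
  have U: "degree (pu m) \<le> r" "coeff (pu m) r = prod \<sigma> {1..r}"
    using coeff_prod_linear[of "{1..r}" "\<lambda>j. poly_u (w j) m (of_real (\<gamma> j))"] du
    by (simp_all add: pu_def \<sigma>_def)
  have "(\<Prod>j=1..r. coeff (poly_v (w j) m (of_real (\<gamma> j))) 1) = (\<Prod>j=1..r. 1 / par_b (w j))"
    by (intro prod.cong cv refl)
  then have V: "degree (pv m) \<le> r" "coeff (pv m) r = 1 / total_b r w"
    using coeff_prod_linear[of "{1..r}" "\<lambda>j. poly_v (w j) m (of_real (\<gamma> j))"] dv
    by (simp_all add: pv_def total_b_def prod_dividef)
  have "prod \<sigma> {1..r} \<noteq> 1 / total_b r w"
  proof (cases "num_weights is_Charlier r w = 0")
    case False
    then have "{j \<in> {1..r}. is_Charlier (w j)} \<noteq> {}"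
      unfolding num_weights_def by (metis card.empty)
    then obtain j where "j \<in> {1..r}" "is_Charlier (w j)" by blast
    then have "\<sigma> j = 0" by (auto simp: \<sigma>_def is_Charlier_def)
    then have "prod \<sigma> {1..r} = 0" using \<open>j \<in> {1..r}\<close> by auto
    then show ?thesis unfolding \<open>prod \<sigma> {1..r} = 0\<close> using B0 by simp
  next
    case rC: True
    then have nC: "\<not> is_Charlier (w j)" if "j \<in> {1..r}" for j
      using that by (auto simp: num_weights_def)
    have \<sigma>: "\<sigma> j = (if is_Meixner (w j) then 1 else - 1)" if "j \<in> {1..r}" for j
      using nC[OF that] nH[OF that] by (cases "w j") (auto simp: \<sigma>_def)
    show ?thesis
    proof (cases "num_weights is_Meixner r w = 0")
      case False
      then have "norm (total_b r w) < 1" using rC MD2 by (auto simp: MD2_def)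
      moreover have "norm (prod \<sigma> {1..r}) = 1"
        unfolding prod_norm[symmetric] by (rule prod.neutral) (auto simp: \<sigma>)
      ultimately show ?thesis using B0 by (auto simp: norm_divide)
    next
      case True
      then have nM: "\<not> is_Meixner (w j)" if "j \<in> {1..r}" for j
        using that by (auto simp: num_weights_def)
      have K: "is_Kravchuk (w j)" if "j \<in> {1..r}" for j
        using nC[OF that] nH[OF that] nM[OF that] by (cases "w j") auto
      then have "{j \<in> {1..r}. is_Kravchuk (w j)} = {1..r}" by blast
      then have "num_weights is_Kravchuk r w = r" by (simp add: num_weights_def)
      then have "total_b r w \<noteq> (- 1) ^ r" using MD2 by (simp add: MD2_def)
      moreover have "prod \<sigma> {1..r} = (\<Prod>j\<in>{1..r}. - 1)" using nM by (intro prod.cong) (auto simp: \<sigma>)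
      then have "prod \<sigma> {1..r} = (- 1) ^ r" by simp
      \<comment> \<open>(-1)^r is its own inverse, so 1/B = (-1)^r would force B = (-1)^r.\<close>
      ultimately show ?thesis using B0
        by (cases "even r") (auto simp: field_simps minus_equation_iff[of "total_b r w" 1])
    qed
  qed
  then show ?thesis using U V by simp
qed

text \<open>Both polynomials are the same scalar C times r + 1 monic linear factors. Their
  coefficients at r + 1 therefore agree, and those at r differ by C times the difference of the sums
  of constant terms, in which the shifts \<gamma> cancel.\<close>

lemma coeff_diff_Hahn:
  fixes \<gamma> :: "nat \<Rightarrow> real"
  assumes h: "h \<in> {1..r}" "w h = Hahn \<alpha> \<beta> N"
    and K: "\<And>j. j \<in> {1..r} - {h} \<Longrightarrow> is_Kravchuk (w j)" and B: "total_b r w = (- 1) ^ (r - 1)"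
    and nz: "\<alpha> + of_nat m \<noteq> 0" "\<beta> + of_nat m \<noteq> 0"
  defines "pu \<equiv> \<Prod>j=1..r. poly_u (w j) m (of_real (\<gamma> j))"
  defines "pv \<equiv> \<Prod>j=1..r. poly_v (w j) m (of_real (\<gamma> j))"
  shows "\<exists>C. C \<noteq> 0 \<and> degree pu \<le> Suc r \<and> degree pv \<le> Suc r \<and> coeff pu (Suc r) = C \<and> coeff pv (Suc r) = C \<and>
    coeff pu r - coeff pv r =
      C * (\<alpha> + \<beta> + of_nat m + of_nat r * of_nat m - (\<Sum>j\<in>{1..r} - {h}. of_nat (the_enat (par_N (w j)))))"
proof -
  define \<nu> :: "nat \<Rightarrow> complex" where "\<nu> = (\<lambda>j. of_nat (the_enat (par_N (w j))))"
  \<comment> \<open>The Hahn quotient contributes -1 over the denominator. The sign power comes from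
    the Kravchuk factors of U, and for V from the product of the 1/b, which is 1/B.\<close>
  define C where "C = - ((- 1) ^ (r - 1)) / ((\<alpha> + of_nat m) * (\<beta> + of_nat m))"
  \<comment> \<open>The free index \<open>0\<close> carries the second linear factor of the Hahn quotient.\<close>
  define a where "a = (\<lambda>j. if j = 0 then \<alpha> + of_nat m - of_real (\<gamma> h) else of_nat m - \<nu> j - of_real (\<gamma> j))"
  define b where "b = (\<lambda>j. if j = 0 then - (of_nat N + \<beta> + of_real (\<gamma> h)) else - complex_of_real (\<gamma> j))"
  have split: "(\<Prod>j=1..r. f j) = f h * (\<Prod>j\<in>{1..r} - {h}. f j)" for f :: "nat \<Rightarrow> 'x::comm_monoid_mult"
    using h(1) by (simp add: prod.remove)
  have h0: "h \<noteq> 0" using h(1) by simp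
  have Kj: "\<exists>c M. w j = Kravchuk c M \<and> j \<noteq> 0" if "j \<in> {1..r} - {h}" for j
    using K[OF that] that by (auto simp: is_Kravchuk_def)
  have card: "card ({1..r} - {h}) = r - 1" using h(1) by simp
  have I: "insert 0 {1..r} = {0..r}" by auto
  have ins: "(\<Prod>j=0..r. f j) = f 0 * (\<Prod>j=1..r. f j)" for f :: "nat \<Rightarrow> complex poly"
    unfolding I[symmetric] by (rule prod.insert) auto
  have hu: "poly_u (w h) m (of_real (\<gamma> h))
      = smult (- 1 / ((\<alpha> + of_nat m) * (\<beta> + of_nat m))) ([:a 0, 1:] * [:a h, 1:])"
    by (simp only: h(2) poly_u.simps) (simp add: a_def \<nu>_def h(2) h0)
  have hv: "poly_v (w h) m (of_real (\<gamma> h))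
      = smult (- 1 / ((\<alpha> + of_nat m) * (\<beta> + of_nat m))) ([:b 0, 1:] * [:b h, 1:])"
    by (simp only: h(2) poly_v.simps) (simp add: b_def h0)
  have "(\<Prod>j\<in>{1..r} - {h}. par_b (w j)) = (- 1) ^ (r - 1)"
    using B split[of "\<lambda>j. par_b (w j)"] by (simp add: total_b_def h(2))
  then have Bh: "(\<Prod>j\<in>{1..r} - {h}. 1 / par_b (w j)) = (- 1) ^ (r - 1)"
    by (cases "even (r - 1)") (auto simp: prod_dividef)
  have "(\<Prod>j\<in>{1..r} - {h}. poly_u (w j) m (of_real (\<gamma> j))) = (\<Prod>j\<in>{1..r} - {h}. smult (- 1) [:a j, 1:])"
    using Kj by (intro prod.cong) (force simp: a_def \<nu>_def)+
  then have pu: "pu = smult C (\<Prod>j=0..r. [:a j, 1:])"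
    by (simp only: pu_def ins split hu prod_smult prod_constant card mult_smult_left mult_smult_right
        smult_smult mult.assoc) (simp add: C_def)
  have "(\<Prod>j\<in>{1..r} - {h}. poly_v (w j) m (of_real (\<gamma> j))) = (\<Prod>j\<in>{1..r} - {h}. smult (1 / par_b (w j)) [:b j, 1:])"
    using Kj by (intro prod.cong) (force simp: b_def)+
  then have pv: "pv = smult C (\<Prod>j=0..r. [:b j, 1:])"
    by (simp only: pv_def ins split hv prod_smult Bh mult_smult_left mult_smult_right
        smult_smult mult.assoc) (simp add: C_def)
  have monic: "degree (\<Prod>j=0..r. [:f j, 1:]) \<le> Suc r"
    "coeff (\<Prod>j=0..r. [:f j, 1:]) (Suc r) = 1" "coeff (\<Prod>j=0..r. [:f j, 1:]) r = (\<Sum>j=0..r. f j)"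
    for f :: "nat \<Rightarrow> complex"
    using coeff_prod_monic_linear_top[of "{0..r}" f] coeff_prod_monic_linear_next[of "{0..r}" f]
      coeff_prod_linear[of "{0..r}" "\<lambda>j. [:f j, 1:]"]
    by simp_all
  have sums: "(\<Sum>j=0..r. a j) - (\<Sum>j=0..r. b j)
      = \<alpha> + \<beta> + of_nat m + of_nat r * of_nat m - (\<Sum>j\<in>{1..r} - {h}. \<nu> j)"
  proof -
    have sins: "(\<Sum>j=0..r. f j) = f 0 + (\<Sum>j=1..r. f j)" for f :: "nat \<Rightarrow> complex"
      unfolding I[symmetric] by (rule sum.insert) auto
    have "(\<Sum>j=0..r. a j) - (\<Sum>j=0..r. b j) = (\<Sum>j=0..r. a j - b j)" by (simp add: sum_subtractf)
    also have "\<dots> = (\<alpha> + of_nat m + of_nat N + \<beta>) + (\<Sum>j=1..r. of_nat m - \<nu> j)"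
      unfolding sins by (simp add: a_def b_def)
    also have "(\<Sum>j=1..r. of_nat m - \<nu> j) = of_nat r * of_nat m - (\<Sum>j=1..r. \<nu> j)"
      by (simp add: sum_subtractf)
    \<comment> \<open>The N of the Hahn weight, present in b at index 0, cancels against this
      summand.\<close>
    also have "(\<Sum>j=1..r. \<nu> j) = of_nat N + (\<Sum>j\<in>{1..r} - {h}. \<nu> j)"
      using h by (simp add: sum.remove \<nu>_def)
    finally show ?thesis by (simp add: algebra_simps)
  qed
  have "coeff pu r - coeff pv r = C * ((\<Sum>j=0..r. a j) - (\<Sum>j=0..r. b j))"
    by (simp add: pu pv monic right_diff_distrib)
  moreover have "C \<noteq> 0" using nz by (simp add: C_def)
  moreover have "degree pu \<le> Suc r" "degree pv \<le> Suc r" "coeff pu (Suc r) = C" "coeff pv (Suc r) = C"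
    using monic by (simp_all add: pu pv degree_smult_eq)
  ultimately show ?thesis unfolding sums \<nu>_def by blast
qed

subsection \<open>Summation by parts\<close>

definition poly_summable :: "complex \<Rightarrow> (complex \<Rightarrow> complex) \<Rightarrow> bool" where
  "poly_summable c f \<longleftrightarrow>
    (\<forall>p. (\<lambda>i::int. poly p (c + of_int i) * f (c + of_int i)) summable_on UNIV)"

lemma bij_int_pred: "bij_betw (\<lambda>i::int. i - 1) UNIV UNIV"
  by (rule bij_betwI[where g = "\<lambda>i. i + 1"]) auto

lemma infsum_diff:
  fixes f g :: "'a \<Rightarrow> complex"
  assumes "f summable_on A" "g summable_on A"
  shows "infsum (\<lambda>x. f x - g x) A = infsum f A - infsum g A"
  using infsum_add[OF assms(1) summable_on_uminus[THEN iffD2, OF assms(2)]]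
  by (simp add: infsum_uminus)

text \<open>Shifting the index by 1 permutes the integers and moves the shift from f to the
  polynomial; absolute control of both parts allows splitting the sum.\<close>

lemma summation_by_parts:
  assumes f: "poly_summable c f"
  defines "S \<equiv> \<lambda>g. \<Sum>\<^sub>\<infinity>i::int. g (c + of_int i)"
  shows "poly_summable c (backward_diff f)"
    and "S (\<lambda>x. poly p x * backward_diff f x) = S (\<lambda>x. poly (p - pcompose p [:1, 1:]) x * f x)"
proof -
  have shift: "(\<lambda>i::int. poly p (c + of_int i) * f (c + of_int i - 1)) =
      (\<lambda>i. (\<lambda>i::int. poly (pcompose p [:1, 1:]) (c + of_int i) * f (c + of_int i)) (i - 1))" for p
    by (simp add: fun_eq_iff poly_pcompose algebra_simps)
  have sum1: "(\<lambda>i::int. poly p (c + of_int i) * f (c + of_int i)) summable_on UNIV" for p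
    using f by (simp add: poly_summable_def)
  have sum2: "(\<lambda>i::int. poly p (c + of_int i) * f (c + of_int i - 1)) summable_on UNIV" for p
    unfolding shift using sum1[of "pcompose p [:1, 1:]"] by (subst summable_on_reindex_bij_betw[OF bij_int_pred])
  show "poly_summable c (backward_diff f)"
    unfolding poly_summable_def backward_diff_def right_diff_distrib
    using summable_on_add[OF sum1 summable_on_uminus[THEN iffD2, OF sum2]] by simp
  have "S (\<lambda>x. poly p x * backward_diff f x)
      = S (\<lambda>x. poly p x * f x) - S (\<lambda>x. poly p x * f (x - 1))"
    unfolding S_def backward_diff_def right_diff_distrib by (rule infsum_diff[OF sum1 sum2])
  also have "S (\<lambda>x. poly p x * f (x - 1)) = S (\<lambda>x. poly (pcompose p [:1, 1:]) x * f x)"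
    unfolding S_def shift by (rule infsum_reindex_bij_betw[OF bij_int_pred])
  also have "S (\<lambda>x. poly p x * f x) - \<dots> = S (\<lambda>x. poly p x * f x - poly (pcompose p [:1, 1:]) x * f x)"
    unfolding S_def by (rule infsum_diff[OF sum1 sum1, symmetric])
  finally show "S (\<lambda>x. poly p x * backward_diff f x) = S (\<lambda>x. poly (p - pcompose p [:1, 1:]) x * f x)"
    by (simp add: left_diff_distrib)
qed

lemma poly_summable_funpow:
  "poly_summable c f \<Longrightarrow> poly_summable c ((backward_diff ^^ n) f)"
  by (induction n) (auto intro: summation_by_parts(1))

text \<open>With q(x) = p(x + 1), this is minus the backward difference of q. The zero alternative
  covers constants, for which degree < n fails at n = 0.\<close>

lemma poly_shift_diff_degree:
  fixes p :: "complex poly"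
  assumes "degree p < Suc n"
  shows "p - pcompose p [:1, 1:] = 0 \<or> degree (p - pcompose p [:1, 1:]) < n"
proof (cases "degree p")
  case 0
  then obtain c where "p = [:c:]" by (metis degree_eq_zeroE)
  then show ?thesis by simp
next
  case (Suc d)
  define q where "q = pcompose p [:1, 1:]"
  have "pcompose q [:- 1, 1:] = pcompose p (pcompose [:1, 1:] [:- 1, 1:])"
    by (simp only: q_def pcompose_assoc)
  also have "pcompose [:1, 1:] [:- 1, 1:] = ([:0, 1:] :: complex poly)" by (simp add: pcompose_pCons)
  finally have "pcompose q [:- 1, 1:] = p" by simp
  moreover have "degree q = Suc d" using Suc by (simp add: q_def degree_pcompose)
  ultimately have "degree (q - p) \<le> d" using poly_shift_diff[of q d] by simp
  then have "degree (p - q) \<le> d" using degree_minus[of "q - p"] by simp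
  then show ?thesis using Suc assms by (simp add: q_def)
qed

text \<open>Each summation by parts removes one difference from f and lowers the degree of p, so
  after n of them the polynomial is 0; this is the alternative p = 0 of the base case.\<close>

lemma sum_poly_times_funpow_diff:
  assumes f: "poly_summable c f"
  shows "p = 0 \<or> degree p < n \<Longrightarrow>
    ((\<lambda>i::int. poly p (c + of_int i) * (backward_diff ^^ n) f (c + of_int i)) has_sum 0) UNIV"
proof (induction n arbitrary: p)
  case 0
  then show ?case by simp
next
  case (Suc n)
  have summ: "poly_summable c ((backward_diff ^^ k) f)" for k
    using f by (rule poly_summable_funpow)
  let ?g = "(backward_diff ^^ n) f" and ?p = "p - pcompose p [:1, 1:]"
  have "?p = 0 \<or> degree ?p < n"
    using Suc.prems poly_shift_diff_degree[of p n] by auto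
  then have "(\<Sum>\<^sub>\<infinity>i::int. poly ?p (c + of_int i) * ?g (c + of_int i)) = 0"
    by (intro infsumI Suc.IH)
  then have "(\<Sum>\<^sub>\<infinity>i::int. poly p (c + of_int i) * (backward_diff ^^ Suc n) f (c + of_int i)) = 0"
    using summation_by_parts(2)[OF summ[of n], of p] by simp
  moreover have "(\<lambda>i::int. poly p (c + of_int i) * (backward_diff ^^ Suc n) f (c + of_int i)) summable_on UNIV"
    using summ[of "Suc n"] by (simp add: poly_summable_def)
  ultimately show ?case by (metis has_sum_infsum)
qed

lemma poly_summable_finite_support:
  assumes "finite {i::int. f (c + of_int i) \<noteq> 0}"
  shows "poly_summable c f"
  unfolding poly_summable_def
proof
  fix p
  have "finite {i \<in> UNIV. poly p (c + of_int i) * f (c + of_int i) \<noteq> 0}"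
    by (rule finite_subset[OF _ assms]) auto
  then show "(\<lambda>i::int. poly p (c + of_int i) * f (c + of_int i)) summable_on UNIV"
    by (rule finite_nonzero_values_imp_summable_on)
qed

section \<open>Summability on infinite lattices by the ratio test\<close>

lemma tendsto_shift_quotient:
  fixes a b :: complex
  shows "(\<lambda>i. (a + of_nat i) / (b + of_nat i)) \<longlonglongrightarrow> 1"
proof -
  have "filterlim (\<lambda>i. b + of_nat i) at_infinity sequentially"
    by (rule tendsto_add_filterlim_at_infinity[OF tendsto_const tendsto_of_nat])
  then have "(\<lambda>i. 1 + (a - b) / (b + of_nat i)) \<longlonglongrightarrow> 1 + 0"
    by (intro tendsto_add tendsto_const tendsto_divide_0[OF tendsto_const])
  moreover have "\<forall>\<^sub>F i in sequentially. (b + of_nat i) \<noteq> 0"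
    using \<open>filterlim (\<lambda>i. b + of_nat i) at_infinity sequentially\<close>
    by (rule filterlim_at_infinity_imp_eventually_ne)
  then have "\<forall>\<^sub>F i in sequentially. 1 + (a - b) / (b + of_nat i) = (a + of_nat i) / (b + of_nat i)"
    by eventually_elim (simp add: field_simps)
  ultimately show ?thesis by (simp add: tendsto_cong)
qed

text \<open>It suffices to treat powers of c + i. Such a power multiplies the ratio of consecutive
  terms by a quantity tending to 1, so the limit L is unchanged and any number strictly between |L|
  and 1 serves in the ratio test.\<close>

lemma poly_summable_ratio:
  assumes neg: "\<And>i::int. i < 0 \<Longrightarrow> f (c + of_int i) = 0"
    and step: "\<And>i::nat. f (c + of_nat (Suc i)) = f (c + of_nat i) * t i"
    and t: "t \<longlonglongrightarrow> L" and L: "norm L < 1"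
  shows "poly_summable c f"
  unfolding poly_summable_def
proof
  fix p :: "complex poly"
  have mono: "(\<lambda>i. norm ((c + of_nat i) ^ k * f (c + of_nat i))) summable_on UNIV" for k
  proof -
    let ?g = "\<lambda>i. (c + of_nat i) ^ k * f (c + of_nat i)"
    let ?s = "\<lambda>i. ((c + 1 + of_nat i) / (c + of_nat i)) ^ k * t i"
    obtain \<rho> where \<rho>: "norm L < \<rho>" "\<rho> < 1" using L dense by blast
    have "?s \<longlonglongrightarrow> 1 ^ k * L"
      by (intro tendsto_intros tendsto_shift_quotient t)
    then have "(\<lambda>i. norm (?s i)) \<longlonglongrightarrow> norm L" using tendsto_norm by fastforce
    then have "\<forall>\<^sub>F i in sequentially. norm (?s i) < \<rho>" by (rule order_tendstoD(2)) (rule \<rho>)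
    moreover have "filterlim (\<lambda>i. c + of_nat i) at_infinity sequentially"
      by (rule tendsto_add_filterlim_at_infinity[OF tendsto_const tendsto_of_nat])
    then have "\<forall>\<^sub>F i in sequentially. c + of_nat i \<noteq> 0"
      by (rule filterlim_at_infinity_imp_eventually_ne)
    ultimately have "\<forall>\<^sub>F i in sequentially. norm (?g (Suc i)) \<le> \<rho> * norm (?g i)"
    proof eventually_elim
      case (elim i)
      have "c + of_nat (Suc i) = c + 1 + of_nat i" by simp
      then have "?g (Suc i) = ?s i * ?g i"
        using elim(2) step[of i] by (simp add: power_divide add.assoc)
      then show ?case using elim(1) by (simp add: norm_mult mult_right_mono del: of_nat_Suc)
    qed
    then obtain M where "\<And>i. i \<ge> M \<Longrightarrow> norm (?g (Suc i)) \<le> \<rho> * norm (?g i)"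
      by (auto simp: eventually_sequentially)
    then have "summable (\<lambda>i. norm (?g i))"
      using \<rho>(2) by (intro summable_ratio_test[of \<rho> M]) simp_all
    then show ?thesis by (simp add: summable_on_UNIV_nonneg_real_iff)
  qed
  have summ: "(\<lambda>i. \<Sum>k\<in>K. g k i) summable_on UNIV"
    if "finite K" "\<And>k. g k summable_on UNIV" for K :: "nat set" and g :: "nat \<Rightarrow> nat \<Rightarrow> complex"
    using that(1) by (induction K rule: finite_induct) (auto intro: summable_on_add that(2))
  have "(\<lambda>i. \<Sum>k\<le>degree p. coeff p k * ((c + of_nat i) ^ k * f (c + of_nat i))) summable_on (UNIV :: nat set)"
    by (intro summ summable_on_cmult_right abs_summable_summable[OF mono]) simp
  then have "(\<lambda>i. poly p (c + of_nat i) * f (c + of_nat i)) summable_on (UNIV :: nat set)"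
    by (simp add: poly_altdef sum_distrib_right mult.assoc)
  then have "(\<lambda>i::int. poly p (c + of_int i) * f (c + of_int i)) summable_on range int"
    by (subst summable_on_reindex) (auto simp: o_def)
  moreover have "i \<ge> 0 \<Longrightarrow> i \<in> range int" for i by (metis nat_0_le rangeI)
  then have "poly p (c + of_int i) * f (c + of_int i) = 0" if "i \<in> UNIV - range int" for i
    using neg[of i] that by force
  ultimately show "(\<lambda>i::int. poly p (c + of_int i) * f (c + of_int i)) summable_on UNIV"
    by (subst summable_on_cong_neutral[of "range int"]) auto
qed

subsection \<open>Systems satisfying Condition MD2\<close>

lemma Uw_Vw_commute:
  "Vw r w \<gamma> m x * Uw r w \<gamma> (Suc m) (x - 1) = Uw r w \<gamma> m x * Vw r w \<gamma> (Suc m) x"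
proof -
  have "x - 1 - of_real (\<gamma> j) = x - of_real (\<gamma> j) - 1" for j by simp
  then show ?thesis by (simp only: Uw_def Vw_def flip: prod.distrib) (simp only: quot_commute)
qed

lemma Rw_Suc:
  assumes "\<And>j. j \<in> {1..r} \<Longrightarrow> exp (l j) = par_b (w j)"
    and "\<And>j. j \<in> {1..r} \<Longrightarrow> quot_defined (w j) m"
    and "\<And>j. j \<in> {1..r} \<Longrightarrow> regular_point (w j) (x - of_real (\<gamma> j))"
  shows "Rw r l w \<gamma> (Suc m) x = Rw r l w \<gamma> m x * Uw r w \<gamma> m x"
    and "Rw r l w \<gamma> (Suc m) (x - 1) = Rw r l w \<gamma> m x * Vw r w \<gamma> m x"
proof -
  have "x - 1 - of_real (\<gamma> j) = x - of_real (\<gamma> j) - 1" for j by simp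
  then have down: "rho (l j) (w j) (Suc m) (x - 1 - of_real (\<gamma> j))
      = rho (l j) (w j) m (x - of_real (\<gamma> j)) * quot_v (w j) m (x - of_real (\<gamma> j))" if "j \<in> {1..r}" for j
    using rho_Suc(2)[OF assms[OF that]] by (simp only:)
  show "Rw r l w \<gamma> (Suc m) x = Rw r l w \<gamma> m x * Uw r w \<gamma> m x"
    unfolding Rw_def Uw_def prod.distrib[symmetric] by (intro prod.cong refl rho_Suc(1) assms)
  show "Rw r l w \<gamma> (Suc m) (x - 1) = Rw r l w \<gamma> m x * Vw r w \<gamma> m x"
    unfolding Rw_def Vw_def prod.distrib[symmetric] by (intro prod.cong refl down)
qed

lemma regular_point_shift [simp]: "regular_point w (x - 1) \<longleftrightarrow> regular_point w x"
proof -
  have e: "y - 1 \<in> \<int> \<longleftrightarrow> y \<in> \<int>" for y :: complex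
    by (metis Ints_1 Ints_add Ints_diff diff_add_cancel)
  have "x - 1 + a = x + a - 1" "x - 1 - a = x - a - 1" for a by simp_all
  then show ?thesis by (simp only: regular_point_def e)
qed

text \<open>The factor 1/Gamma(x + 1) vanishes for i < 0 and 1/Gamma(N - m - x + 1) for i > N;
  raising m only adds zeros.\<close>

lemma rho_zero_off_lattice:
  assumes "i < 0 \<or> par_N w < enat (nat i)"
  shows "rho l w m (of_int i) = 0"
proof -
  have z: "rGamma (of_int k) = 0" if "k \<le> 0" for k :: int
    using that by (simp add: rGamma_eq_zero_iff nonpos_Ints_of_int)
  show ?thesis
  proof (cases "i < 0")
    case True
    then have "rGamma (of_int i + 1) = (0::complex)" using z[of "i + 1"] by simp
    then show ?thesis by (cases w) simp_all
  next
    case False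
    have "rGamma (of_nat N - of_nat m - of_int i + 1) = (0::complex)" if "par_N w = enat N" for N
    proof -
      have "N < nat i" using that False assms by simp
      then have "int N - int m - i + 1 \<le> 0" by linarith
      then show ?thesis using z[of "int N - int m - i + 1"] by simp
    qed
    then show ?thesis using assms False by (cases w) simp_all
  qed
qed

text \<open>This is the limiting growth ratio of one weight along x + 1, x + 2, and so on. Kravchuk
  weights matter too, since on the lattice of another weight they are not cut off; their
  \<open>quot_u\<close> has leading coefficient -1, hence the sign.\<close>

lemma quot_ratio_tendsto:
  assumes "\<not> is_Hahn w"
  shows "(\<lambda>i. quot_u w m (d + of_nat i) / quot_v w m (d + of_nat i + 1))
    \<longlonglongrightarrow> (if is_Charlier w then 0 else if is_Meixner w then par_b w else - par_b w)"
proof (cases w)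
  case (Charlier b)
  have "filterlim (\<lambda>i. (d + 1) + of_nat i) at_infinity sequentially"
    by (rule tendsto_add_filterlim_at_infinity[OF tendsto_const tendsto_of_nat])
  then have "(\<lambda>i. b / ((d + 1) + of_nat i)) \<longlonglongrightarrow> 0"
    by (intro tendsto_divide_0[OF tendsto_const])
  then show ?thesis by (simp add: Charlier algebra_simps)
next
  case (Meixner \<alpha> b)
  have "(\<lambda>i. b * ((d + \<alpha> + of_nat m + of_nat i) / (d + 1 + of_nat i))) \<longlonglongrightarrow> b * 1"
    by (intro tendsto_intros tendsto_shift_quotient)
  then show ?thesis by (simp add: Meixner algebra_simps)
next
  case (Kravchuk b N)
  have "(\<lambda>i. - b * ((d - of_nat N + of_nat m + of_nat i) / (d + 1 + of_nat i))) \<longlonglongrightarrow> - b * 1"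
    by (intro tendsto_intros tendsto_shift_quotient)
  moreover have "- b * ((d - of_nat N + of_nat m + of_nat i) / (d + 1 + of_nat i))
      = quot_u w m (d + of_nat i) / quot_v w m (d + of_nat i + 1)" for i
    by (simp add: Kravchuk add_ac minus_divide_left[symmetric] flip: minus_divide_left mult_minus_right)
  ultimately show ?thesis by (simp add: Kravchuk)
next
  case (Hahn \<alpha> \<beta> N)
  then show ?thesis using assms by simp
qed

context
  fixes r :: nat and w :: "nat \<Rightarrow> weight" and l :: "nat \<Rightarrow> complex" and \<gamma> :: "nat \<Rightarrow> real" and n :: nat
  assumes r: "r \<ge> 1" and MD2: "MD2 r w"
    and l: "\<And>j. j \<in> {1..r} \<Longrightarrow> exp (l j) = par_b (w j)"
    and generic: "\<And>j k. \<lbrakk>j \<in> {1..r}; k \<in> {1..r}; j \<noteq> k\<rbrakk> \<Longrightarrow>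
      \<gamma> j - \<gamma> k \<notin> \<int> \<and>
      complex_of_real (\<gamma> j - \<gamma> k) - par_alpha (w j) \<notin> \<int> \<and>
      complex_of_real (\<gamma> j - \<gamma> k) - par_beta (w k) \<notin> \<int>"
    and n: "enat n \<le> min_N r w"
begin

text \<open>A Hahn weight at h together with r - 1 Kravchuk weights leaves, by counting, only
  Kravchuk weights at the other indices.\<close>

lemma Hahn_case:
  assumes h: "h \<in> {1..r}" and H: "is_Hahn (w h)"
  shows "\<And>j. j \<in> {1..r} - {h} \<Longrightarrow> is_Kravchuk (w j)" and "total_b r w = (- 1) ^ (r - 1)"
    and "enat i < par_N (w h) \<Longrightarrow> par_alpha (w h) \<noteq> - of_nat i \<and> par_beta (w h) \<noteq> - of_nat i"
    and "enat m < min_N r w \<Longrightarrow> i \<le> m \<Longrightarrow>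
      par_alpha (w h) + par_beta (w h) + of_nat (r * m)
        - (\<Sum>j\<in>{1..r} - {h}. of_nat (the_enat (par_N (w j)))) \<noteq> - of_nat i"
proof -
  have "num_weights is_Hahn r w > 0" using h H by (auto simp: num_weights_def card_gt_0_iff)
  then have K: "num_weights is_Kravchuk r w = r - 1" and B: "total_b r w = (- 1) ^ (r - 1)"
    and *: "\<forall>h\<in>{1..r}. is_Hahn (w h) \<longrightarrow>
        (\<forall>i. enat i < par_N (w h) \<longrightarrow>
              par_alpha (w h) \<noteq> - of_nat i \<and> par_beta (w h) \<noteq> - of_nat i) \<and>
        (\<forall>n. enat n < min_N r w \<longrightarrow>
              (\<forall>i\<le>n. par_alpha (w h) + par_beta (w h) + of_nat (r * n)
                       - (\<Sum>j\<in>{1..r} - {h}. of_nat (the_enat (par_N (w j)))) \<noteq> - of_nat i))"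
    using MD2 unfolding MD2_def by blast+
  have "{j \<in> {1..r}. is_Kravchuk (w j)} \<subseteq> {1..r} - {h}"
    using H by (auto simp: is_Hahn_def is_Kravchuk_def)
  then have "{j \<in> {1..r}. is_Kravchuk (w j)} = {1..r} - {h}"
    using K h by (intro card_subset_eq) (auto simp: num_weights_def)
  then show "\<And>j. j \<in> {1..r} - {h} \<Longrightarrow> is_Kravchuk (w j)" by blast
  show "total_b r w = (- 1) ^ (r - 1)" by (rule B)
  show "enat i < par_N (w h) \<Longrightarrow> par_alpha (w h) \<noteq> - of_nat i \<and> par_beta (w h) \<noteq> - of_nat i"
    using * h H by blast
  show "enat m < min_N r w \<Longrightarrow> i \<le> m \<Longrightarrow>
      par_alpha (w h) + par_beta (w h) + of_nat (r * m)
        - (\<Sum>j\<in>{1..r} - {h}. of_nat (the_enat (par_N (w j)))) \<noteq> - of_nat i"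
    using * h H by blast
qed

lemma min_N_le: "j \<in> {1..r} \<Longrightarrow> min_N r w \<le> par_N (w j)"
  unfolding min_N_def by (intro Min_le) auto

text \<open>Here m < n \<le> N, the range in which the Hahn parameters of MD2 avoid -m.\<close>

lemma quot_defined_below:
  assumes j: "j \<in> {1..r}" and m: "m < n"
  shows "quot_defined (w j) m"
proof -
  have "enat m < par_N (w j)"
    using m n min_N_le[OF j] by (meson enat_ord_simps(2) less_le_trans)
  then show ?thesis using Hahn_case(3)[OF j] unfolding quot_defined_def by (metis add_eq_0_iff2)
qed

text \<open>For its own weight the point is an integer and the Meixner clause of MD2 applies; for
  any other weight it is a noninteger by genericity, which is unaffected by integer shifts.\<close>

lemma regular_lattice:
  assumes j: "j \<in> {1..r}" and k: "k \<in> {1..r}"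
  shows "regular_point (w k) (of_real (\<gamma> j) + of_int i - of_real (\<gamma> k))"
proof (cases "k = j")
  case True
  have "is_Meixner (w k) \<longrightarrow> par_alpha (w k) \<notin> \<int>\<^sub>\<le>\<^sub>0" using MD2 k by (simp add: MD2_def)
  then show ?thesis using True by (simp add: regular_point_def)
next
  case False
  define d where "d = complex_of_real (\<gamma> j - \<gamma> k)"
  have x: "of_real (\<gamma> j) + of_int i - of_real (\<gamma> k) = d + of_int i" by (simp add: d_def)
  have add_int: "z + of_int i \<in> \<int> \<longleftrightarrow> z \<in> \<int>" for z :: complex
    by (metis Ints_add Ints_diff Ints_of_int add_diff_cancel_right')
  have "d \<notin> \<int>" using generic[OF j k] False by (simp add: d_def del: of_real_diff)
  \<comment> \<open>The genericity condition on \<alpha> is used for the pair (k, j) with the sign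
    reversed, the one on \<beta> for (j, k).\<close>
  moreover have "d + par_alpha (w k) = - (complex_of_real (\<gamma> k - \<gamma> j) - par_alpha (w k))"
    by (simp add: d_def)
  then have "d + par_alpha (w k) \<notin> \<int>" using generic[OF k j] False by (metis minus_in_Ints_iff)
  moreover have "d - par_beta (w k) \<notin> \<int>" using generic[OF j k] False by (simp add: d_def)
  moreover have "d + of_int i + par_alpha (w k) = d + par_alpha (w k) + of_int i"
    "d + of_int i - par_beta (w k) = d - par_beta (w k) + of_int i"
    by simp_all
  ultimately show ?thesis unfolding x regular_point_def by (simp only: add_int) simp
qed

lemma rodrigues_times_weight:
  assumes "\<And>j. j \<in> {1..r} \<Longrightarrow> regular_point (w j) (x - of_real (\<gamma> j))"
  shows "rodrigues r w \<gamma> n x * Rw r l w \<gamma> 0 x = (backward_diff ^^ n) (Rw r l w \<gamma> n) x"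
proof -
  let ?L = "{x. \<forall>j\<in>{1..r}. regular_point (w j) (x - of_real (\<gamma> j))}"
  have e: "x - 1 - of_real (\<gamma> j) = x - of_real (\<gamma> j) - 1" for x j by simp
  show ?thesis
    unfolding rodrigues_eq_sum
  proof (rule rodrigues_sum_times_weight[where L = ?L and R = "Rw r l w \<gamma>"])
    show "Vw r w \<gamma> m x * Uw r w \<gamma> (Suc m) (x - 1) = Uw r w \<gamma> m x * Vw r w \<gamma> (Suc m) x" for m x
      by (rule Uw_Vw_commute)
    show "Rw r l w \<gamma> (Suc m) x = Rw r l w \<gamma> m x * Uw r w \<gamma> m x" if "m < n" "x \<in> ?L" for m x
      using that by (intro Rw_Suc l quot_defined_below) auto
    show "Rw r l w \<gamma> (Suc m) (x - 1) = Rw r l w \<gamma> m x * Vw r w \<gamma> m x" if "m < n" "x \<in> ?L" for m x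
      using that by (intro Rw_Suc l quot_defined_below) auto
    show "x - 1 \<in> ?L" if "x \<in> ?L" for x
      using that by (simp only: mem_Collect_eq e regular_point_shift)
    show "x \<in> ?L" using assms by simp
  qed simp
qed

lemma rodrigues_identity_cosparse:
  "\<forall>\<^sub>\<approx>x. rodrigues r w \<gamma> n x * Rw r l w \<gamma> 0 x = (backward_diff ^^ n) (Rw r l w \<gamma> n) x"
proof -
  have "\<forall>\<^sub>\<approx>x. \<forall>j\<in>{1..r}. x + (- of_real (\<gamma> j)) \<notin> \<int> \<and> x + (par_alpha (w j) - of_real (\<gamma> j)) \<notin> \<int> \<and>
      x + (- par_beta (w j) - of_real (\<gamma> j)) \<notin> \<int>"
    by (intro eventually_ball_finite ballI eventually_conj eventually_cosparse_not_Ints) simp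
  then show ?thesis
  proof eventually_elim
    case (elim x)
    show ?case
    proof (rule rodrigues_times_weight)
      fix j assume "j \<in> {1..r}"
      then show "regular_point (w j) (x - of_real (\<gamma> j))"
        using elim by (force simp: regular_point_def algebra_simps)
    qed
  qed
qed

lemma rodrigues_degree:
  "\<exists>p :: complex poly. p \<noteq> 0 \<and> degree p = r * n \<and> (\<forall>x. rodrigues r w \<gamma> n x = poly p x)"
proof -
  define pu where "pu = (\<lambda>m. \<Prod>j=1..r. poly_u (w j) m (of_real (\<gamma> j)))"
  define pv where "pv = (\<lambda>m. \<Prod>j=1..r. poly_v (w j) m (of_real (\<gamma> j)))"
  have U: "Uw r w \<gamma> m x = poly (pu m) x" and V: "Vw r w \<gamma> m x = poly (pv m) x" for m x
    by (simp_all add: Uw_def Vw_def pu_def pv_def poly_prod poly_poly_u poly_poly_v)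
  have "degree (pu m) \<le> Suc r \<and> degree (pv m) \<le> Suc r \<and> coeff (pu m) (Suc r) = coeff (pv m) (Suc r) \<and>
    coeff (pu m) r - coeff (pv m) r + of_nat (r * (n - Suc m)) * coeff (pv m) (Suc r) \<noteq> 0"
    if m: "m < n" for m
  proof (cases "\<exists>h\<in>{1..r}. is_Hahn (w h)")
    case False
    then have "degree (pu m) \<le> r \<and> degree (pv m) \<le> r \<and> coeff (pu m) r \<noteq> coeff (pv m) r"
      unfolding pu_def pv_def by (intro coeff_diff_nonzero_no_Hahn r MD2) auto
    \<comment> \<open>Both coefficients at \<open>Suc r\<close> are 0, so the correction by the
      degree disappears.\<close>
    then show ?thesis by (simp add: coeff_eq_0)
  next
    case True
    then obtain h where h: "h \<in> {1..r}" and H: "is_Hahn (w h)" by blast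
    then obtain \<alpha> \<beta> N where wh: "w h = Hahn \<alpha> \<beta> N" by (auto simp: is_Hahn_def)
    let ?\<Sigma> = "\<Sum>j\<in>{1..r} - {h}. complex_of_nat (the_enat (par_N (w j)))"
    have "\<alpha> + of_nat m \<noteq> 0" "\<beta> + of_nat m \<noteq> 0"
      using quot_defined_below[OF h m] by (simp_all add: quot_defined_def wh)
    then obtain C where C: "C \<noteq> 0" "degree (pu m) \<le> Suc r" "degree (pv m) \<le> Suc r"
      "coeff (pu m) (Suc r) = C" "coeff (pv m) (Suc r) = C"
      "coeff (pu m) r - coeff (pv m) r = C * (\<alpha> + \<beta> + of_nat m + of_nat r * of_nat m - ?\<Sigma>)"
      unfolding pu_def pv_def
      using coeff_diff_Hahn[OF h wh Hahn_case(1)[OF h H] Hahn_case(2)[OF h H], of m \<gamma>] by blast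
    \<comment> \<open>MD2 is used at n - 1 with i = m: the r m from the coefficients and the r (n -
      m - 1) from the degree add up to r (n - 1).\<close>
    have "enat (n - 1) < enat n" using m by simp
    then have "enat (n - 1) < min_N r w" using n by (rule less_le_trans)
    then have nz: "\<alpha> + \<beta> + of_nat (r * (n - 1)) - ?\<Sigma> \<noteq> - of_nat m"
      using Hahn_case(4)[OF h H, of "n - 1" m] m by (simp add: wh)
    have "r * (n - 1) = r * m + r * (n - Suc m)"
      using m by (simp flip: distrib_left)
    then have "complex_of_nat (r * (n - 1)) = of_nat r * of_nat m + of_nat (r * (n - Suc m))"
      by (metis of_nat_add of_nat_mult)
    then have "C * (\<alpha> + \<beta> + of_nat m + of_nat r * of_nat m - ?\<Sigma>) + of_nat (r * (n - Suc m)) * C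
        = C * ((\<alpha> + \<beta> + of_nat (r * (n - 1)) - ?\<Sigma>) + of_nat m)"
      by (simp add: algebra_simps)
    also have "\<dots> \<noteq> 0" using C(1) nz by (simp add: eq_neg_iff_add_eq_0)
    finally show ?thesis using C by simp
  qed
  then show ?thesis
    unfolding rodrigues_eq_sum
    by (intro rodrigues_sum_degree[where pu = pu and pv = pv and M = n] Uw_Vw_commute U V) auto
qed

section \<open>Vanishing off the lattices, summability and orthogonality\<close>

lemma Rw_zero_off_lattice:
  assumes j: "j \<in> {1..r}" and i: "i < 0 \<or> par_N (w j) < enat (nat i)"
  shows "Rw r l w \<gamma> m (of_real (\<gamma> j) + of_int i) = 0"
proof -
  have "rho (l j) (w j) m (of_real (\<gamma> j) + of_int i - of_real (\<gamma> j)) = 0"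
    using rho_zero_off_lattice[OF i] by simp
  then show ?thesis using j unfolding Rw_def by (intro prod_zero bexI[of _ j]) simp_all
qed

text \<open>A finite lattice gives finite support. On an infinite one the ratio test applies, with
  the product of the limiting ratios of all weights.\<close>

lemma Rw_poly_summable:
  assumes j: "j \<in> {1..r}"
  shows "poly_summable (of_real (\<gamma> j)) (Rw r l w \<gamma> n)"
proof (cases "par_N (w j)")
  case (enat N)
  have "{i::int. Rw r l w \<gamma> n (of_real (\<gamma> j) + of_int i) \<noteq> 0} \<subseteq> {0..int N}"
    using Rw_zero_off_lattice[OF j, of _ n] enat by (force simp: not_less)
  then show ?thesis by (intro poly_summable_finite_support) (rule finite_subset, auto)
next
  case infinity
  then have CM: "is_Charlier (w j) \<or> is_Meixner (w j)" by (cases "w j") auto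
  \<comment> \<open>A Hahn weight would make the weight at j Kravchuk, whose lattice is
    finite.\<close>
  have nH: "\<not> is_Hahn (w k)" if k: "k \<in> {1..r}" for k
  proof
    assume H: "is_Hahn (w k)"
    then have "k \<noteq> j" using CM by (auto simp: is_Hahn_def)
    then have "is_Kravchuk (w j)" using Hahn_case(1)[OF k H] j by blast
    then show False using CM by (auto simp: is_Kravchuk_def)
  qed
  define d where "d = (\<lambda>k. complex_of_real (\<gamma> j) - of_real (\<gamma> k))"
  define x where "x = (\<lambda>i::nat. complex_of_real (\<gamma> j) + of_nat i)"
  define t where "t = (\<lambda>i. Uw r w \<gamma> n (x i) / Vw r w \<gamma> n (x i + 1))"
  define \<mu> where "\<mu> = (\<lambda>k. if is_Charlier (w k) then 0 else if is_Meixner (w k) then par_b (w k) else - par_b (w k))"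
  have reg: "regular_point (w k) (x i - of_real (\<gamma> k))" if "k \<in> {1..r}" for i k
    using regular_lattice[OF j that, of "int i"] by (simp add: x_def)
  \<comment> \<open>Level n itself is required here, beyond the range of
    \<open>quot_defined_below\<close>.\<close>
  have def: "quot_defined (w k) n" if "k \<in> {1..r}" for k
    using nH[OF that] by (simp add: quot_defined_def)
  \<comment> \<open>The factor of index j has its zero at i + 1 = 0, and a zero of another factor
    would make \<gamma> j - \<gamma> k an integer.\<close>
  have V0: "Vw r w \<gamma> n (x i + 1) \<noteq> 0" for i
  proof -
    have "quot_v (w k) n (x i + 1 - of_real (\<gamma> k)) \<noteq> 0" if k: "k \<in> {1..r}" for k
    proof -
      have "x i + 1 - of_real (\<gamma> k) \<noteq> 0"
      proof (cases "k = j")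
        case True
        have "complex_of_nat (Suc i) \<noteq> 0" by (rule of_nat_neq_0)
        then show ?thesis using True by (simp add: x_def add.commute)
      next
        case False
        show ?thesis
        proof
          assume "x i + 1 - of_real (\<gamma> k) = 0"
          then have "complex_of_real (\<gamma> j - \<gamma> k) = of_int (- int (Suc i))"
            by (simp add: x_def algebra_simps)
          then have "complex_of_real (\<gamma> j - \<gamma> k) \<in> \<int>" by (metis Ints_of_int)
          then show False using generic[OF j k] False by (simp del: of_real_diff)
        qed
      qed
      moreover have "par_b (w k) \<noteq> 0" using l[OF k] by (metis exp_not_eq_zero)
      ultimately show ?thesis using nH[OF k] by (cases "w k") auto
    qed
    then show ?thesis unfolding Vw_def by simp
  qed
  have step: "Rw r l w \<gamma> n (x (Suc i)) = Rw r l w \<gamma> n (x i) * t i" for i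
  proof -
    have x1: "x (Suc i) = x i + 1" "x (Suc i) - 1 = x i" by (simp_all add: x_def)
    \<comment> \<open>The weight of level n + 1 at x i is reached from x i by U and from x (i + 1)
      by V.\<close>
    have "Rw r l w \<gamma> n (x i) * Uw r w \<gamma> n (x i) = Rw r l w \<gamma> (Suc n) (x i)"
      using Rw_Suc(1)[where x = "x i" and m = n and w = w and r = r and l = l and \<gamma> = \<gamma>, OF l def reg] by simp
    also have "\<dots> = Rw r l w \<gamma> n (x (Suc i)) * Vw r w \<gamma> n (x (Suc i))"
      using Rw_Suc(2)[where x = "x (Suc i)" and m = n and w = w and r = r and l = l and \<gamma> = \<gamma>, OF l def reg]
      by (simp add: x1)
    finally show ?thesis using V0[of i] by (simp add: t_def x1 field_simps)
  qed
  have t: "t \<longlonglongrightarrow> prod \<mu> {1..r}"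
  proof -
    have "(\<lambda>i. \<Prod>k=1..r. quot_u (w k) n (d k + of_nat i) / quot_v (w k) n (d k + of_nat i + 1))
        \<longlonglongrightarrow> prod \<mu> {1..r}"
      unfolding \<mu>_def by (intro tendsto_prod quot_ratio_tendsto nH)
    moreover have "x i - of_real (\<gamma> k) = d k + of_nat i" "x i + 1 - of_real (\<gamma> k) = d k + of_nat i + 1" for i k
      by (simp_all add: x_def d_def)
    ultimately show ?thesis by (simp only: t_def Uw_def Vw_def prod_dividef)
  qed
  \<comment> \<open>A Charlier factor makes the limit 0. Otherwise its modulus is |B|, and the
    weight at j is Meixner, so MD2 gives |B| < 1.\<close>
  have L: "norm (prod \<mu> {1..r}) < 1"
  proof (cases "num_weights is_Charlier r w = 0")
    case False
    then have "{k \<in> {1..r}. is_Charlier (w k)} \<noteq> {}"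
      unfolding num_weights_def by (metis card.empty)
    then obtain k where k: "k \<in> {1..r}" "is_Charlier (w k)" by blast
    then have "prod \<mu> {1..r} = 0" by (intro prod_zero) (auto simp: \<mu>_def)
    then show ?thesis by (simp only: norm_zero zero_less_one)
  next
    case True
    then have nC: "\<not> is_Charlier (w k)" if "k \<in> {1..r}" for k
      using that by (auto simp: num_weights_def)
    have "norm (prod \<mu> {1..r}) = norm (total_b r w)"
      unfolding total_b_def prod_norm[symmetric] by (rule prod.cong) (auto simp: \<mu>_def nC)
    moreover have "num_weights is_Meixner r w > 0"
      using CM nC[OF j] j by (auto simp: num_weights_def card_gt_0_iff)
    ultimately show ?thesis using MD2 True by (simp only: MD2_def)
  qed
  show ?thesis
  proof (rule poly_summable_ratio[OF _ _ t L])
    show "Rw r l w \<gamma> n (of_real (\<gamma> j) + of_int i) = 0" if "i < 0" for i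
      using Rw_zero_off_lattice[OF j] that by blast
    show "Rw r l w \<gamma> n (of_real (\<gamma> j) + of_nat (Suc i)) = Rw r l w \<gamma> n (of_real (\<gamma> j) + of_nat i) * t i" for i
      using step[of i] by (simp only: x_def)
  qed
qed

lemma rodrigues_orthogonal:
  assumes j: "j \<in> {1..r}" and k: "k < n"
  shows "((\<lambda>x. rodrigues r w \<gamma> n x * x ^ k * Rw r l w \<gamma> 0 x) has_sum 0)
    ((\<lambda>s. complex_of_real (\<gamma> j) + s) ` weight_lattice (w j))"
proof -
  let ?h = "\<lambda>x. rodrigues r w \<gamma> n x * x ^ k * Rw r l w \<gamma> 0 x"
  let ?x = "\<lambda>i::int. complex_of_real (\<gamma> j) + of_int i"
  let ?T = "int ` {i. enat i \<le> par_N (w j)}"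
  have "((\<lambda>i::int. poly (monom 1 k) (?x i) * (backward_diff ^^ n) (Rw r l w \<gamma> n) (?x i)) has_sum 0) UNIV"
    using k by (intro sum_poly_times_funpow_diff Rw_poly_summable j) (simp add: degree_monom_eq)
  moreover have "poly (monom 1 k) (?x i) * (backward_diff ^^ n) (Rw r l w \<gamma> n) (?x i) = ?h (?x i)" for i
    using rodrigues_times_weight[OF regular_lattice[OF j], of i] by (simp add: poly_monom mult_ac)
  ultimately have "((\<lambda>i. ?h (?x i)) has_sum 0) UNIV" by (simp only:)
  \<comment> \<open>The sum so far runs over all integers; restricting it to the lattice drops only
    zero terms.\<close>
  moreover have "?h (?x i) = 0" if "i \<in> UNIV - ?T" for i
  proof -
    have "i < 0 \<or> par_N (w j) < enat (nat i)"
    proof (rule ccontr)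
      assume "\<not> ?thesis"
      then have "i = int (nat i)" "enat (nat i) \<le> par_N (w j)" by (auto simp: not_less)
      then show False using that by blast
    qed
    then show ?thesis using Rw_zero_off_lattice[OF j] by simp
  qed
  ultimately have "((\<lambda>i. ?h (?x i)) has_sum 0) ?T"
    by (subst has_sum_cong_neutral[where T = UNIV and g = "\<lambda>i. ?h (?x i)"]) auto
  moreover have "inj_on ?x ?T" by (auto simp: inj_on_def)
  ultimately have "(?h has_sum 0) (?x ` ?T)" by (simp add: has_sum_reindex o_def)
  moreover have "?x ` ?T = (\<lambda>s. complex_of_real (\<gamma> j) + s) ` weight_lattice (w j)"
    by (simp add: weight_lattice_def image_image)
  ultimately show ?thesis by (simp only:)
qed

end

theorem theorem2:
  fixes r n :: nat
    and w :: "nat \<Rightarrow> weight"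
    and l :: "nat \<Rightarrow> complex"
    and \<gamma> :: "nat \<Rightarrow> real"
  assumes "r \<ge> 1"
    and "MD2 r w"
    and "\<forall>j\<in>{1..r}. exp (l j) = par_b (w j)"
    and "\<forall>j\<in>{1..r}. \<forall>k\<in>{1..r}. j \<noteq> k \<longrightarrow>
           \<gamma> j - \<gamma> k \<notin> \<int> \<and>
           complex_of_real (\<gamma> j - \<gamma> k) - par_alpha (w j) \<notin> \<int> \<and>
           complex_of_real (\<gamma> j - \<gamma> k) - par_beta (w k) \<notin> \<int>"
    and "enat n \<le> min_N r w"
  shows "(\<forall>\<^sub>\<approx>x. rodrigues r w \<gamma> n x * Rw r l w \<gamma> 0 x
                 = (backward_diff ^^ n) (Rw r l w \<gamma> n) x) \<and>
         (\<exists>p :: complex poly. p \<noteq> 0 \<and> degree p = r * n \<and>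
            (\<forall>x. rodrigues r w \<gamma> n x = poly p x)) \<and>
         (\<forall>j\<in>{1..r}. \<forall>k<n.
            ((\<lambda>x. rodrigues r w \<gamma> n x * x ^ k * Rw r l w \<gamma> 0 x) has_sum 0)
              ((\<lambda>s. complex_of_real (\<gamma> j) + s) ` weight_lattice (w j)))"
proof (intro conjI ballI allI impI)
  note hyps = assms(1,2) bspec[OF assms(3)] assms(4)[rule_format] assms(5)
  show "\<forall>\<^sub>\<approx>x. rodrigues r w \<gamma> n x * Rw r l w \<gamma> 0 x = (backward_diff ^^ n) (Rw r l w \<gamma> n) x"
    by (rule rodrigues_identity_cosparse[OF hyps])
  show "\<exists>p :: complex poly. p \<noteq> 0 \<and> degree p = r * n \<and> (\<forall>x. rodrigues r w \<gamma> n x = poly p x)"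
    by (rule rodrigues_degree[OF hyps])
  show "((\<lambda>x. rodrigues r w \<gamma> n x * x ^ k * Rw r l w \<gamma> 0 x) has_sum 0)
      ((\<lambda>s. complex_of_real (\<gamma> j) + s) ` weight_lattice (w j))" if "j \<in> {1..r}" "k < n" for j k
    by (rule rodrigues_orthogonal[OF hyps that])
qed

end
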